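(* Let $n,N\in\mathbb N$, let $\widehat{\mathsf Q}_1,\dots,\widehat{\mathsf Q}_N\in\mathcal S^n$ with sample mean $\overline{\mathsf Q}=\frac1N\sum_{i=1}^N\widehat{\mathsf Q}_i$ and empirical measure $\widehat{\mathbb P}_N=\frac1N\sum_{i=1}^N\delta_{\widehat{\mathsf Q}_i}$, and put $\mathsf Q_{\rm nom}=\overline{\mathsf Q}$. Each of the following problems is equivalent (same optimal value and same optimal $\mathbf x\in\Delta$) to the deterministic standard quadratic problem $$\min_{\mathbf x\in\Delta}\ \mathbf x^\top(\overline{\mathsf Q}+\theta\,\mathsf I)\mathbf x .$$ (i) (Robust) For $\theta>0$: $\displaystyle\min_{\mathbf x\in\Delta}\max_{\mathsf Q\in\mathcal Q}\mathbf x^\top\mathsf Q\mathbf x$ with $\mathcal Q=\{\mathsf Q\in\mathcal S^n:\|\mathsf Q-\mathsf Q_{\rm nom}\|_F\le\theta\}$. (ii) (Chance-constrained) For $\alpha\in(0.5,1)$ and $\beta>0$: $\displaystyle\min_{\mathbf x\in\Delta}\operatorname{VaR}_\alpha[\mathbf x^\top\widetilde{\mathsf Q}\mathbf x]$, in either of the two cases - $\widetilde{\mathsf Q}=\mathsf Q_{\rm nom}+\beta\widetilde{\mathsf G}$ with $\widetilde{\mathsf G}\sim\operatorname{GOE}(n)$ and $\theta:=\sqrt2\,\beta\,\Phi^{-1}(\alpha)>0$; - $\widetilde{\mathsf Q}=\mathsf Q_{\rm nom}+\beta\widetilde{\mathsf W}$ with $\widetilde{\mathsf W}\sim\mathcal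 W_n(\mathsf I,k)$, $k\in\mathbb N$, and $\theta:=2\beta P^{-1}(\tfrac k2,\alpha)$. (iii) (Distributionally robust) For any $p\ge1$ and $\theta>0$: $\displaystyle\inf_{\mathbf x\in\Delta}\sup_{\mathbb P\in\mathbb B_{\theta,p}(\widehat{\mathbb P}_N)}\mathbb E_{\mathbb P}[\mathbf x^\top\widetilde{\mathsf Q}\mathbf x]$, with Wasserstein distance taken with respect to the Frobenius norm.
   Context: $\mathcal S^n$: real symmetric $n\times n$ matrices; $\mathsf I$: identity; $\|\cdot\|_F$: Frobenius norm; $\Delta=\{\mathbf x\in\mathbb R^n:\mathbf x\ge\mathbf 0,\sum_ix_i=1\}$. The Value-at-Risk of a real random variable $\tilde\zeta$ at level $\alpha$ is $\operatorname{VaR}_\alpha[\tilde\zeta]=\inf\{t\in\mathbb R:\Pr[\tilde\zeta\le t]\ge\alpha\}$. $\Phi^{-1}$ is the inverse of the standard normal cumulative distribution function. $P(a,\cdot)$ is the regularized lower incomplete gamma function $P(a,x)=\frac1{\Gamma(a)}\int_0^xt^{a-1}e^{-t}\,\mathrm dt$ and $P^{-1}(a,\cdot)$ its inverse in the second argument. $\widetilde{\mathsf G}=(\tilde g_{ij})\sim\operatorname{GOE}(n)$ means $\widetilde{\mathsf G}$ is symmetric, $\tilde g_{ii}\sim\mathcal N(0,2)$, $\tilde g_{ij}\sim\mathcal N(0,1)$ for $i<j$, and all entries $\tilde g_{ij}$, $i\le j$, are independent. $\widetilde{\mathsf W}\sim\mathcal W_n(\mathsf I,k)$ means $\widetilde{\mathsf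 W}=\widetilde{\mathsf Y}\widetilde{\mathsf Y}^\top$ where the $k$ columns of $\widetilde{\mathsf Y}$ are i.i.d. $\mathcal N_n(\mathbf 0,\mathsf I)$. The Wasserstein distance on Borel probability measures on $\mathcal S^n$ is $W_p(\mathbb P,\mathbb P')=\big(\inf_{\pi}\int\|\mathsf Q-\mathsf Q'\|_F^p\,\mathrm d\pi\big)^{1/p}$ over couplings $\pi$ of $\mathbb P,\mathbb P'$, and $\mathbb B_{\theta,p}(\mathbb P')=\{\mathbb P:W_p(\mathbb P,\mathbb P')\le\theta\}$; $\mathbb E_{\mathbb P}$ is expectation when $\widetilde{\mathsf Q}$ has law $\mathbb P$. *)

theory Defs
  imports "HOL-Probability.Probability"
begin

definition sym_mats :: "(real^'n^'n) set" where
  "sym_mats = {Q. transpose Q = Q}"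

text \<open>The library norm on matrices, used throughout, is the Frobenius norm.\<close>

lemma norm_matrix_eq_frobenius:
  fixes Q :: "real^'n^'m"
  shows "norm Q = sqrt (\<Sum>i\<in>UNIV. \<Sum>j\<in>UNIV. (Q $ i $ j)\<^sup>2)"
  by (simp add: norm_vec_def L2_set_def sum_nonneg)

definition std_simplex :: "(real^'n) set" where
  "std_simplex = {x. (\<forall>i. 0 \<le> x $ i) \<and> (\<Sum>i\<in>UNIV. x $ i) = 1}"

definition quad_form :: "real^'n^'n \<Rightarrow> real^'n \<Rightarrow> real" where
  "quad_form Q x = x \<bullet> (Q *v x)"

definition sample_mean :: "nat \<Rightarrow> (nat \<Rightarrow> real^'n^'n) \<Rightarrow> real^'n^'n" where
  "sample_mean N Q = (1 / real N) *\<^sub>R (\<Sum>i=1..N. Q i)"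

text \<open>
  Two minimization problems over the same feasible set are equivalent if both attain their
  minimum, the optimal values agree and the sets of minimizers agree.  Objectives take values
  in the extended reals, so that no convention about real suprema of unbounded sets enters.
\<close>

definition equivalent_min :: "'a set \<Rightarrow> ('a \<Rightarrow> ereal) \<Rightarrow> ('a \<Rightarrow> ereal) \<Rightarrow> bool" where
  "equivalent_min X f g \<longleftrightarrow>
     (\<exists>x. is_arg_min f (\<lambda>y. y \<in> X) x) \<and>
     (\<exists>x. is_arg_min g (\<lambda>y. y \<in> X) x) \<and>
     (INF x\<in>X. f x) = (INF x\<in>X. g x) \<and>
     (\<forall>x. is_arg_min f (\<lambda>y. y \<in> X) x \<longleftrightarrow> is_arg_min g (\<lambda>y. y \<in> X) x)"

definition stqp_objective :: "real^'n^'n \<Rightarrow> real \<Rightarrow> real^'n \<Rightarrow> ereal" where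
  "stqp_objective Q \<theta> x = ereal (quad_form (Q + \<theta> *\<^sub>R mat 1) x)"

definition uncertainty_set :: "real^'n^'n \<Rightarrow> real \<Rightarrow> (real^'n^'n) set" where
  "uncertainty_set Qnom \<theta> = {Q \<in> sym_mats. norm (Q - Qnom) \<le> \<theta>}"

definition robust_objective :: "real^'n^'n \<Rightarrow> real \<Rightarrow> real^'n \<Rightarrow> ereal" where
  "robust_objective Qnom \<theta> x = (SUP Q\<in>uncertainty_set Qnom \<theta>. ereal (quad_form Q x))"

definition VaR :: "'w measure \<Rightarrow> real \<Rightarrow> ('w \<Rightarrow> real) \<Rightarrow> ereal" where
  "VaR M \<alpha> Z = Inf (ereal ` {t. \<alpha> \<le> measure M {\<omega> \<in> space M. Z \<omega> \<le> t}})"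

definition std_normal_quantile :: "real \<Rightarrow> real" where
  "std_normal_quantile = inv (cdf std_normal_distribution)"

definition reg_lower_gamma :: "real \<Rightarrow> real \<Rightarrow> real" where
  "reg_lower_gamma a x = (1 / Gamma a) * (LINT t:{0..x}|lborel. t powr (a - 1) * exp (- t))"

definition inv_reg_lower_gamma :: "real \<Rightarrow> real \<Rightarrow> real" where
  "inv_reg_lower_gamma a = inv_into {0..} (reg_lower_gamma a)"

text \<open>The second parameter of \<^const>\<open>normal_density\<close> is the standard deviation.\<close>

definition GOE :: "'w measure \<Rightarrow> ('w \<Rightarrow> real^('n::{finite,linorder})^('n::{finite,linorder})) \<Rightarrow> bool" where
  "GOE M G \<longleftrightarrow>
     (\<forall>\<omega>\<in>space M. G \<omega> \<in> sym_mats) \<and>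
     (\<forall>i. distributed M lborel (\<lambda>\<omega>. G \<omega> $ i $ i) (normal_density 0 (sqrt 2))) \<and>
     (\<forall>i j. i < j \<longrightarrow> distributed M lborel (\<lambda>\<omega>. G \<omega> $ i $ j) (normal_density 0 1)) \<and>
     prob_space.indep_vars M (\<lambda>_. borel) (\<lambda>(i, j) \<omega>. G \<omega> $ i $ j) {(i, j). i \<le> j}"

text \<open>The Lebesgue density of the multivariate normal distribution $N_n(0, I)$.\<close>

definition std_mvn_density :: "real^'n \<Rightarrow> real" where
  "std_mvn_density v = (2 * pi) powr (- real CARD('n) / 2) * exp (- (norm v)\<^sup>2 / 2)"

text \<open>
  \<open>Y l\<close>, for \<open>l < k\<close>, are the columns of the $n \times k$ matrix $Y$ in $W = Y Y^T$.
\<close>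

definition Wishart :: "'w measure \<Rightarrow> nat \<Rightarrow> ('w \<Rightarrow> real^'n^'n) \<Rightarrow> bool" where
  "Wishart M k W \<longleftrightarrow>
     (\<exists>Y :: nat \<Rightarrow> 'w \<Rightarrow> real^'n.
        (\<forall>l<k. distributed M lborel (Y l) std_mvn_density) \<and>
        prob_space.indep_vars M (\<lambda>_. borel) Y {..<k} \<and>
        (\<forall>\<omega>\<in>space M. W \<omega> = (\<chi> i j. \<Sum>l<k. Y l \<omega> $ i * Y l \<omega> $ j)))"

definition chance_objective ::
  "'w measure \<Rightarrow> real \<Rightarrow> ('w \<Rightarrow> real^'n^'n) \<Rightarrow> real^'n \<Rightarrow> ereal" where
  "chance_objective M \<alpha> Q x = VaR M \<alpha> (\<lambda>\<omega>. quad_form (Q \<omega>) x)"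

definition sym_borel :: "(real^'n^'n) measure" where
  "sym_borel = restrict_space borel sym_mats"

definition sym_prob_measures :: "(real^'n^'n) measure set" where
  "sym_prob_measures = {P. prob_space P \<and> sets P = sets sym_borel}"

text \<open>The average of the Dirac measures at \<open>Q 1, \<dots>, Q N\<close>, as an image of the uniform distribution on \<open>{1..N}\<close>.\<close>

definition empirical_measure :: "nat \<Rightarrow> (nat \<Rightarrow> real^'n^'n) \<Rightarrow> (real^'n^'n) measure" where
  "empirical_measure N Q = distr (uniform_count_measure {1..N}) sym_borel Q"

lemma measure_empirical_measure:
  assumes "N \<ge> 1" "\<And>i. i \<in> {1..N} \<Longrightarrow> Q i \<in> sym_mats" "A \<in> sets sym_borel"
  shows "measure (empirical_measure N Q) A = (1 / real N) * (\<Sum>i=1..N. indicator A (Q i))"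
proof -
  have "Q \<in> measurable (uniform_count_measure {1..N}) sym_borel"
    using assms(2)
    by (auto simp: sym_borel_def measurable_def space_uniform_count_measure
        sets_uniform_count_measure space_restrict_space)
  then have "measure (empirical_measure N Q) A =
      measure (uniform_count_measure {1..N}) (Q -` A \<inter> {1..N})"
    using assms(3) by (simp add: empirical_measure_def measure_distr space_uniform_count_measure)
  also have "\<dots> = real (card (Q -` A \<inter> {1..N})) / real N"
    by (subst measure_uniform_count_measure) auto
  also have "real (card (Q -` A \<inter> {1..N})) = (\<Sum>i=1..N. indicator A (Q i))"
    by (simp add: indicator_def sum.If_cases Int_def vimage_def conj_commute)
  finally show ?thesis by simp
qed

definition couplings ::
  "(real^'n^'n) measure \<Rightarrow> (real^'n^'n) measure \<Rightarrow> ((real^'n^'n) \<times> (real^'n^'n)) measure set" where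
  "couplings P P' =
     {\<pi>. prob_space \<pi> \<and> sets \<pi> = sets (sym_borel \<Otimes>\<^sub>M sym_borel) \<and>
         distr \<pi> sym_borel fst = P \<and> distr \<pi> sym_borel snd = P'}"

text \<open>The $p$-th root on $[0,\infty]$, with $\infty^{1/p} = \infty$.\<close>

definition ennreal_root :: "real \<Rightarrow> ennreal \<Rightarrow> ennreal" where
  "ennreal_root p c = (if c = \<infinity> then \<infinity> else ennreal (enn2real c powr (1 / p)))"

definition wasserstein :: "real \<Rightarrow> (real^'n^'n) measure \<Rightarrow> (real^'n^'n) measure \<Rightarrow> ennreal" where
  "wasserstein p P P' =
     ennreal_root p
       (INF \<pi>\<in>couplings P P'. \<integral>\<^sup>+(Q, Q'). ennreal (norm (Q - Q') powr p) \<partial>\<pi>)"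

definition wasserstein_ball ::
  "real \<Rightarrow> real \<Rightarrow> (real^'n^'n) measure \<Rightarrow> (real^'n^'n) measure set" where
  "wasserstein_ball \<theta> p P' = {P \<in> sym_prob_measures. wasserstein p P P' \<le> ennreal \<theta>}"

text \<open>
  For $p \ge 1$ every measure in a Wasserstein ball around an empirical measure has a finite
  first moment, so the Bochner integral below is a genuine expectation.
\<close>

definition dro_objective ::
  "real \<Rightarrow> real \<Rightarrow> (real^'n^'n) measure \<Rightarrow> real^'n \<Rightarrow> ereal" where
  "dro_objective \<theta> p P' x =
     (SUP P\<in>wasserstein_ball \<theta> p P'. ereal (\<integral>Q. quad_form Q x \<partial>P))"

end

theory Submission
  imports Defs
begin

text \<open>
  Every quadratic form is the Frobenius inner product $x^T Q x = \langle x x^T, Q\rangle$, and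
  $\|x x^T\|_F = \|x\|^2$.  All four objectives therefore penalize the nominal value by a multiple
  of $\|x\|^2 = x^T I x$: pointwise for every $x \in \Delta$ they equal
  $x^T \overline Q x + \theta \|x\|^2$, which is the objective of the standard quadratic problem.
  Pointwise equality, together with compactness of the simplex, gives equivalence of the problems
  (\<open>equivalent_min_stqp\<close>).

  In the robust problem Cauchy--Schwarz bounds the penalty by $\theta \|x\|^2$, and the symmetric
  matrix $\theta\, x x^T / \|x\|^2$ attains the bound (\<open>robust_worst_case\<close>).  In the
  distributionally robust problem the form is Lipschitz with constant $\|x\|^2$, so that the mean
  over a coupling grows by at most $\|x\|^2$ times the transport cost; moving the whole
  centre by the same matrix attains the bound for every $p$ (\<open>dro_objective_eq\<close>).

  For the chance constraints the noise is, in law, $\|x\|^2$ times a fixed random variable $T$.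
  For the GOE, $x^T G x$ is a linear combination of independent normals with variance
  $2 \|x\|^4$, so that $T$ is normal (\<open>GOE_quad_form\<close>).  For the Wishart matrix,
  $x^T W x = \sum_l (x^T Y_l)^2$ with $x^T Y_l \sim N(0, \|x\|^2)$, so that $T$ is chi-square with
  $k$ degrees of freedom, that is, twice a Gamma variable of shape $k/2$
  (\<open>Wishart_quad_form\<close>).  Value-at-Risk commutes with increasing affine maps (\<open>VaR_affine\<close>),
  hence the penalty is the quantile of $T$ times $\beta \|x\|^2$.
\<close>

section \<open>Quadratic forms on the standard simplex\<close>

definition outer :: "real^'n \<Rightarrow> real^'n^'n" where
  "outer x = (\<chi> i j. x $ i * x $ j)"

lemma quad_form_eq_inner_outer: "quad_form Q x = outer x \<bullet> Q"
  by (simp add: quad_form_def outer_def inner_vec_def matrix_vector_mult_def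
      sum_distrib_left algebra_simps)

lemma quad_form_eq_sum: "quad_form Q x = (\<Sum>i\<in>UNIV. \<Sum>j\<in>UNIV. x $ i * x $ j * Q $ i $ j)"
  by (simp add: quad_form_eq_inner_outer outer_def inner_vec_def)

lemma norm_outer: "norm (outer x) = (norm x)\<^sup>2"
proof -
  have "(norm (outer x))\<^sup>2 = ((norm x)\<^sup>2)\<^sup>2"
    unfolding power2_norm_eq_inner
    by (simp add: outer_def inner_vec_def power2_eq_square sum_product algebra_simps)
  then show ?thesis by (simp only: power2_eq_iff_nonneg norm_ge_zero zero_le_power2)
qed

lemma outer_sym: "outer x \<in> sym_mats"
  by (simp add: sym_mats_def outer_def transpose_def vec_eq_iff)

lemma sym_matsD: "Q \<in> sym_mats \<Longrightarrow> Q $ i $ j = Q $ j $ i"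
  unfolding sym_mats_def mem_Collect_eq vec_eq_iff by (simp add: transpose_def)

lemma subspace_sym_mats: "subspace sym_mats"
  by (auto simp: subspace_def sym_mats_def transpose_def vec_eq_iff)

lemma quad_form_add: "quad_form (A + B) x = quad_form A x + quad_form B x"
  by (simp add: quad_form_eq_inner_outer inner_add_right)

lemma quad_form_scale: "quad_form (c *\<^sub>R A) x = c * quad_form A x"
  by (simp add: quad_form_eq_inner_outer)

lemma quad_form_diff_le: "quad_form A x \<le> quad_form B x + (norm x)\<^sup>2 * norm (A - B)"
  using norm_cauchy_schwarz[of "outer x" "A - B"]
  by (simp add: quad_form_eq_inner_outer norm_outer inner_diff_right)

lemma stqp_objective_eq: "stqp_objective Q \<theta> x = ereal (quad_form Q x + \<theta> * (norm x)\<^sup>2)"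
  by (simp add: stqp_objective_def quad_form_add quad_form_scale)
     (simp add: quad_form_def power2_norm_eq_inner)

lemma std_simplex_nonzero: "x \<in> std_simplex \<Longrightarrow> x \<noteq> 0"
  by (auto simp: std_simplex_def)

lemma compact_std_simplex: "compact (std_simplex :: (real^'n) set)"
proof -
  have "norm x \<le> 1" if "x \<in> std_simplex" for x :: "real^'n"
    using norm_le_l1_cart[of x] that by (simp add: std_simplex_def)
  then have "bounded (std_simplex :: (real^'n) set)"
    unfolding bounded_iff by blast
  moreover have "closed (std_simplex :: (real^'n) set)"
    unfolding std_simplex_def
    by (intro closed_Collect_conj closed_Collect_all closed_Collect_le closed_Collect_eq continuous_intros)
  ultimately show ?thesis
    by (simp add: compact_eq_bounded_closed)
qed

lemma std_simplex_nonempty: "(std_simplex :: (real^'n) set) \<noteq> {}"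
proof -
  have "axis (undefined::'n) 1 \<in> (std_simplex :: (real^'n) set)"
    by (auto simp: std_simplex_def axis_def)
  then show ?thesis by blast
qed

text \<open>
  A continuous function attains its minimum on a compact set, and everything else in the notion of
  equivalence depends only on the values on \<open>X\<close>.
\<close>

lemma equivalent_min_if_eq_on_compact:
  assumes "compact X" "X \<noteq> {}" and cont: "continuous_on X h"
    and f: "\<And>x. x \<in> X \<Longrightarrow> f x = ereal (h x)" and g: "\<And>x. x \<in> X \<Longrightarrow> g x = ereal (h x)"
  shows "equivalent_min X f g"
proof -
  obtain x where x: "x \<in> X" "\<And>y. y \<in> X \<Longrightarrow> h x \<le> h y"
    using continuous_attains_inf[OF assms(1-3)] by blast
  have "is_arg_min f (\<lambda>y. y \<in> X) x" "is_arg_min g (\<lambda>y. y \<in> X) x"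
    using x f g by (auto simp: is_arg_min_def not_less)
  moreover have "(INF x\<in>X. f x) = (INF x\<in>X. g x)"
    using f g by (intro INF_cong) auto
  moreover have "is_arg_min f (\<lambda>y. y \<in> X) x \<longleftrightarrow> is_arg_min g (\<lambda>y. y \<in> X) x" for x
    using f g by (auto simp: is_arg_min_def)
  ultimately show ?thesis unfolding equivalent_min_def by blast
qed

lemma equivalent_min_stqp:
  assumes "\<And>x. x \<in> std_simplex \<Longrightarrow> f x = ereal (quad_form Q x + \<theta> * (norm x)\<^sup>2)"
  shows "equivalent_min std_simplex f (stqp_objective Q \<theta>)"
  using compact_std_simplex std_simplex_nonempty _ assms stqp_objective_eq
  by (rule equivalent_min_if_eq_on_compact)
     (auto simp: quad_form_eq_sum intro!: continuous_intros)

lemma sample_mean_sym: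
  assumes "\<And>i. i \<in> {1..N} \<Longrightarrow> Q i \<in> sym_mats"
  shows "sample_mean N Q \<in> sym_mats"
  unfolding sample_mean_def
  using assms by (intro subspace_scale subspace_sum subspace_sym_mats) auto

section \<open>The robust problem\<close>

text \<open>
  The multiple of $x x^T$ of Frobenius norm \<open>\<theta>\<close>: by the equality case of
  Cauchy--Schwarz it is the perturbation of that size that raises the form at \<open>x\<close> the most.
\<close>

definition worst_shift :: "real \<Rightarrow> real^'n \<Rightarrow> real^'n^'n" where
  "worst_shift \<theta> x = (\<theta> / (norm x)\<^sup>2) *\<^sub>R outer x"

lemma worst_shift:
  assumes "x \<noteq> 0" "\<theta> \<ge> 0"
  shows worst_shift_sym: "worst_shift \<theta> x \<in> sym_mats"
    and norm_worst_shift: "norm (worst_shift \<theta> x) = \<theta>"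
    and quad_form_worst_shift: "quad_form (worst_shift \<theta> x) x = \<theta> * (norm x)\<^sup>2"
  using assms
  by (auto simp: worst_shift_def norm_outer quad_form_scale intro!: subspace_scale subspace_sym_mats outer_sym)
     (simp add: quad_form_eq_inner_outer flip: power2_norm_eq_inner, simp add: norm_outer power2_eq_square)

lemma robust_worst_case:
  assumes "x \<noteq> 0" "\<theta> \<ge> 0" "Qnom \<in> sym_mats"
  shows "is_arg_max (\<lambda>Q. quad_form Q x) (\<lambda>Q. Q \<in> uncertainty_set Qnom \<theta>) (Qnom + worst_shift \<theta> x)"
    and "robust_objective Qnom \<theta> x = ereal (quad_form Qnom x + \<theta> * (norm x)\<^sup>2)"
proof -
  let ?Q = "Qnom + worst_shift \<theta> x"
  have mem: "?Q \<in> uncertainty_set Qnom \<theta>"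
    using assms by (simp add: uncertainty_set_def norm_worst_shift subspace_add subspace_sym_mats worst_shift_sym)
  have val: "quad_form ?Q x = quad_form Qnom x + \<theta> * (norm x)\<^sup>2"
    using assms by (simp add: quad_form_add quad_form_worst_shift)
  have le: "quad_form Q x \<le> quad_form ?Q x" if "Q \<in> uncertainty_set Qnom \<theta>" for Q
  proof -
    have "quad_form Q x \<le> quad_form Qnom x + (norm x)\<^sup>2 * norm (Q - Qnom)"
      by (rule quad_form_diff_le)
    also have "(norm x)\<^sup>2 * norm (Q - Qnom) \<le> (norm x)\<^sup>2 * \<theta>"
      using that by (intro mult_left_mono) (auto simp: uncertainty_set_def)
    finally show ?thesis by (simp add: val mult.commute)
  qed
  show "is_arg_max (\<lambda>Q. quad_form Q x) (\<lambda>Q. Q \<in> uncertainty_set Qnom \<theta>) ?Q"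
    using mem le by (auto simp: is_arg_max_def not_less)
  show "robust_objective Qnom \<theta> x = ereal (quad_form Qnom x + \<theta> * (norm x)\<^sup>2)"
    unfolding robust_objective_def val[symmetric]
    using mem le by (intro antisym SUP_least SUP_upper) auto
qed

section \<open>The distributionally robust problem\<close>

text \<open>
  The graph of the convex function $t \mapsto t^p$ lies above its tangent at \<open>c\<close>.  Solved for
  \<open>d\<close>, this bounds a distance by an affine function of its $p$-th power.  Integrated, it yields
  both integrability of the distance and the bound $E\,d \le c$ whenever
  $E\,d^p \le c^p$, in place of Jensen's inequality.
\<close>

lemma powr_tangent:
  fixes c d p :: real
  assumes "c > 0" "d \<ge> 0" "p \<ge> 1"
  shows "d \<le> c + (d powr p - c powr p) / (p * c powr (p - 1))"
proof (cases "d = 0")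
  case True
  have "c powr p = c * c powr (p - 1)" using assms by (simp add: powr_mult_base)
  then show ?thesis using True assms by (simp add: field_simps)
next
  case False
  have "d powr p - c powr p \<ge> (p * c powr (p - 1)) * (d - c)"
  proof (rule convex_on_imp_above_tangent[where A = "{0<..}"])
    show "((\<lambda>x. x powr p) has_field_derivative p * c powr (p - 1)) (at c within {0<..})"
      using assms by (auto intro!: derivative_eq_intros simp: has_field_derivative_at_within)
  qed (use False assms in \<open>auto simp: powr_convex interior_open\<close>)
  then show ?thesis using assms by (simp add: field_simps)
qed

lemma measurable_fst_snd_sym_borel [measurable]:
  "fst \<in> sym_borel \<Otimes>\<^sub>M sym_borel \<rightarrow>\<^sub>M (borel :: (real^'n^'n) measure)"
  "snd \<in> sym_borel \<Otimes>\<^sub>M sym_borel \<rightarrow>\<^sub>M (borel :: (real^'n^'n) measure)"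
proof -
  have "(\<lambda>x. x) \<in> sym_borel \<rightarrow>\<^sub>M (borel :: (real^'n^'n) measure)"
    unfolding sym_borel_def by (rule measurable_restrict_space1) simp
  from measurable_compose[OF measurable_fst this] measurable_compose[OF measurable_snd this]
  show "fst \<in> sym_borel \<Otimes>\<^sub>M sym_borel \<rightarrow>\<^sub>M (borel :: (real^'n^'n) measure)"
    "snd \<in> sym_borel \<Otimes>\<^sub>M sym_borel \<rightarrow>\<^sub>M (borel :: (real^'n^'n) measure)" by auto
qed

lemma quad_form_measurable_borel [measurable]: "(\<lambda>Q. quad_form Q x) \<in> borel_measurable borel"
  unfolding quad_form_eq_inner_outer by (intro borel_measurable_continuous_onI continuous_intros)

lemma quad_form_measurable_sym [measurable]: "(\<lambda>Q. quad_form Q x) \<in> borel_measurable sym_borel"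
  unfolding sym_borel_def by (rule measurable_restrict_space1) (rule quad_form_measurable_borel)

text \<open>
  The infimum over couplings need not be known to be attained, hence the slack between
  \<open>\<theta>\<close> and \<open>c\<close>.
\<close>

lemma coupling_of_wasserstein_less:
  assumes "wasserstein p P P' \<le> ennreal \<theta>" "0 \<le> \<theta>" "\<theta> < c" "p \<ge> 1"
  obtains \<pi> where "\<pi> \<in> couplings P P'"
    "(\<integral>\<^sup>+z. ennreal (norm (fst z - snd z) powr p) \<partial>\<pi>) < ennreal (c powr p)"
proof -
  define I where "I = (INF \<pi>\<in>couplings P P'. \<integral>\<^sup>+(Q, Q'). ennreal (norm (Q - Q') powr p) \<partial>\<pi>)"
  have W: "ennreal_root p I \<le> ennreal \<theta>"
    using assms(1) by (simp add: wasserstein_def I_def)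
  have fin: "I \<noteq> \<infinity>"
    using W by (auto simp: ennreal_root_def top_unique)
  then have "enn2real I powr (1 / p) \<le> \<theta>"
    using W assms by (simp add: ennreal_root_def)
  then have "(enn2real I powr (1 / p)) powr p \<le> \<theta> powr p"
    using assms by (intro powr_mono2) auto
  then have "enn2real I \<le> \<theta> powr p"
    using assms by (simp add: powr_powr)
  also have "\<dots> < c powr p"
    using assms by (intro powr_less_mono2) auto
  finally have "ennreal (enn2real I) < ennreal (c powr p)"
    by (simp add: ennreal_less_iff)
  also have "ennreal (enn2real I) = I" using fin by (simp add: less_top)
  finally show ?thesis
    using that unfolding I_def INF_less_iff case_prod_beta by blast
qed

text \<open>
  Under a coupling of cost below $c^p$ with $c > \theta$, the two means differ by at most
  $\|x\|^2$ times the mean distance, hence by at most $c \|x\|^2$; then \<open>c\<close> tends to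
  \<open>\<theta>\<close>.  Integrability under \<open>P\<close> is part of the argument: the difference of the two
  forms is dominated by the integrable distance.
\<close>

lemma expectation_le_of_wasserstein:
  assumes P: "P \<in> wasserstein_ball \<theta> p P'" and "p \<ge> 1" "\<theta> > 0"
    and int: "integrable P' (\<lambda>Q. quad_form Q x)"
  shows "(\<integral>Q. quad_form Q x \<partial>P) \<le> (\<integral>Q. quad_form Q x \<partial>P') + \<theta> * (norm x)\<^sup>2"
proof -
  have bound: "(\<integral>Q. quad_form Q x \<partial>P) \<le> (\<integral>Q. quad_form Q x \<partial>P') + c * (norm x)\<^sup>2" if "c > \<theta>" for c
  proof -
    have "wasserstein p P P' \<le> ennreal \<theta>" using P by (simp add: wasserstein_ball_def)
    then obtain \<pi> where \<pi>: "\<pi> \<in> couplings P P'"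
      and cost: "(\<integral>\<^sup>+z. ennreal (norm (fst z - snd z) powr p) \<partial>\<pi>) < ennreal (c powr p)"
      using coupling_of_wasserstein_less[of p P P' \<theta> c] assms \<open>c > \<theta>\<close> by auto
    interpret prob_space \<pi> using \<pi> by (simp add: couplings_def)
    have sets[measurable_cong]: "sets \<pi> = sets (sym_borel \<Otimes>\<^sub>M sym_borel)"
      and marg: "distr \<pi> sym_borel fst = P" "distr \<pi> sym_borel snd = P'"
      using \<pi> by (auto simp: couplings_def)
    define d where "d = (\<lambda>z :: (real^'a^'a) \<times> (real^'a^'a). norm (fst z - snd z))"
    have d[measurable]: "d \<in> borel_measurable \<pi>" unfolding d_def by measurable
    have c: "c > 0" using assms that by simp
    have intp: "integrable \<pi> (\<lambda>z. d z powr p)"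
      using cost by (intro integrableI_nonneg) (auto simp: d_def less_top intro: order.strict_trans)
    have "ennreal (\<integral>z. d z powr p \<partial>\<pi>) < ennreal (c powr p)"
      using cost by (subst nn_integral_eq_integral[OF intp, symmetric]) (auto simp: d_def)
    then have Ep: "(\<integral>z. d z powr p \<partial>\<pi>) \<le> c powr p"
      by (simp add: ennreal_less_iff)
    \<comment> \<open>the tangent bound: integrable, with mean at most \<open>c\<close>, and above the distance\<close>
    let ?t = "\<lambda>z. c + (d z powr p - c powr p) / (p * c powr (p - 1))"
    have intt: "integrable \<pi> ?t" using intp by simp
    have dt: "0 \<le> d z" "d z \<le> ?t z" for z
      using powr_tangent[OF c, of "d z" p] assms by (auto simp: d_def)
    have intd: "integrable \<pi> d"
      using dt by (intro Bochner_Integration.integrable_bound[OF intt]) (auto intro!: AE_I2 order_trans[OF dt(2) abs_ge_self] simp: dt(1))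
    have "(\<integral>z. d z \<partial>\<pi>) \<le> (\<integral>z. ?t z \<partial>\<pi>)"
      using intd intt dt by (intro integral_mono) auto
    also have "\<dots> = c + ((\<integral>z. d z powr p \<partial>\<pi>) - c powr p) / (p * c powr (p - 1))"
      using intp by (simp add: prob_space)
    also have "\<dots> \<le> c"
      using Ep c assms by (simp add: divide_nonpos_pos)
    finally have Ed: "(\<integral>z. d z \<partial>\<pi>) \<le> c" .
    have int2: "integrable \<pi> (\<lambda>z. quad_form (snd z) x)"
      using int unfolding marg(2)[symmetric] by (subst (asm) integrable_distr_eq) auto
    have dif: "\<bar>quad_form (fst z) x - quad_form (snd z) x\<bar> \<le> (norm x)\<^sup>2 * d z" for z
      using quad_form_diff_le[of "fst z" x "snd z"] quad_form_diff_le[of "snd z" x "fst z"]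
      unfolding d_def norm_minus_commute[of "snd z"] by linarith
    have intdif: "integrable \<pi> (\<lambda>z. quad_form (fst z) x - quad_form (snd z) x)"
    proof (rule Bochner_Integration.integrable_bound)
      show "integrable \<pi> (\<lambda>z. (norm x)\<^sup>2 * d z)" using intd by simp
      show "AE z in \<pi>. norm (quad_form (fst z) x - quad_form (snd z) x) \<le> norm ((norm x)\<^sup>2 * d z)"
        using dif order_trans[OF dif abs_ge_self] by (intro AE_I2) simp
    qed measurable
    have "(\<integral>Q. quad_form Q x \<partial>P) = (\<integral>z. quad_form (fst z) x \<partial>\<pi>)"
      unfolding marg(1)[symmetric] by (subst integral_distr) auto
    also have "\<dots> = (\<integral>z. quad_form (fst z) x - quad_form (snd z) x \<partial>\<pi>) + (\<integral>z. quad_form (snd z) x \<partial>\<pi>)"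
      by (subst Bochner_Integration.integral_add[OF intdif int2, symmetric]) simp
    also have "(\<integral>z. quad_form (snd z) x \<partial>\<pi>) = (\<integral>Q. quad_form Q x \<partial>P')"
      unfolding marg(2)[symmetric] by (subst integral_distr) auto
    also have "(\<integral>z. quad_form (fst z) x - quad_form (snd z) x \<partial>\<pi>) \<le> (\<integral>z. (norm x)\<^sup>2 * d z \<partial>\<pi>)"
      using intdif intd dif by (intro integral_mono) (auto intro: order_trans[OF abs_ge_self])
    also have "\<dots> \<le> (norm x)\<^sup>2 * c"
      using Ed by (simp add: mult_left_mono)
    finally show ?thesis by (simp add: algebra_simps)
  qed
  show ?thesis
  proof (rule field_le_epsilon)
    fix e :: real assume "e > 0"
    \<comment> \<open>dividing by $\|x\|^2 + 1$ rather than $\|x\|^2$ also covers \<open>x = 0\<close>\<close>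
    have n: "(norm x)\<^sup>2 + 1 > 0" by (rule add_nonneg_pos) auto
    have "e / ((norm x)\<^sup>2 + 1) * (norm x)\<^sup>2 \<le> e"
      using n \<open>e > 0\<close> by (simp add: divide_le_eq)
    moreover have "\<theta> < \<theta> + e / ((norm x)\<^sup>2 + 1)"
      using n \<open>e > 0\<close> by simp
    note bound[OF this]
    ultimately show "(\<integral>Q. quad_form Q x \<partial>P) \<le> (\<integral>Q. quad_form Q x \<partial>P') + \<theta> * (norm x)\<^sup>2 + e"
      unfolding distrib_right by linarith
  qed
qed

text \<open>
  The translation itself is a coupling that moves every point by exactly \<open>\<theta>\<close>, so its
  cost is $\theta^p$ for every \<open>p\<close>.
\<close>

lemma shifted_measure_in_wasserstein_ball:
  assumes P': "P' \<in> sym_prob_measures" and S: "S \<in> sym_mats" "norm S = \<theta>" and "p \<ge> 1"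
  shows "distr P' sym_borel (\<lambda>Q. Q + S) \<in> wasserstein_ball \<theta> p P'"
    and "integrable P' (\<lambda>Q. quad_form Q x) \<Longrightarrow>
      (\<integral>Q. quad_form Q x \<partial>distr P' sym_borel (\<lambda>Q. Q + S)) = (\<integral>Q. quad_form Q x \<partial>P') + quad_form S x"
proof -
  interpret prob_space P' using P' by (simp add: sym_prob_measures_def)
  have sets[measurable_cong]: "sets P' = sets sym_borel" using P' by (simp add: sym_prob_measures_def)
  have sp: "space P' = sym_mats" using sets_eq_imp_space_eq[OF sets] by (simp add: sym_borel_def space_restrict_space)
  have [measurable]: "(\<lambda>Q. Q + S) \<in> P' \<rightarrow>\<^sub>M sym_borel"
    unfolding sym_borel_def
  proof (rule measurable_restrict_space2)
    show "(\<lambda>Q. Q + S) \<in> space P' \<rightarrow> sym_mats" using S by (auto simp: sp intro: subspace_add subspace_sym_mats)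
    have "(\<lambda>Q. Q) \<in> P' \<rightarrow>\<^sub>M borel"
      unfolding measurable_cong_sets[OF sets refl] sym_borel_def by (rule measurable_restrict_space1) simp
    then show "(\<lambda>Q. Q + S) \<in> P' \<rightarrow>\<^sub>M borel" by simp
  qed
  have [measurable]: "(\<lambda>Q. (Q + S, Q)) \<in> P' \<rightarrow>\<^sub>M sym_borel \<Otimes>\<^sub>M sym_borel" 
    by (intro measurable_Pair) (auto simp: measurable_cong_sets[OF sets refl])
  let ?P = "distr P' sym_borel (\<lambda>Q. Q + S)"
  let ?\<pi> = "distr P' (sym_borel \<Otimes>\<^sub>M sym_borel) (\<lambda>Q. (Q + S, Q))"
  have "distr ?\<pi> sym_borel snd = P'"
    by (subst distr_distr) (auto simp: comp_def sets intro!: distr_id2)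
  moreover have "distr ?\<pi> sym_borel fst = ?P"
    by (subst distr_distr) (auto simp: comp_def)
  ultimately have \<pi>: "?\<pi> \<in> couplings ?P P'"
    by (auto simp: couplings_def intro!: prob_space_distr)
  have "(INF \<pi>\<in>couplings ?P P'. \<integral>\<^sup>+(Q, Q'). ennreal (norm (Q - Q') powr p) \<partial>\<pi>)
     \<le> (\<integral>\<^sup>+(Q, Q'). ennreal (norm (Q - Q') powr p) \<partial>?\<pi>)" (is "?I \<le> _")
    by (rule INF_lower[OF \<pi>])
  also have "\<dots> = ennreal (\<theta> powr p)"
    unfolding case_prod_beta by (subst nn_integral_distr) (auto simp: S emeasure_space_1)
  finally have I: "?I \<le> ennreal (\<theta> powr p)" .
  then have "?I \<noteq> \<infinity>" by (metis ennreal_neq_top infinity_ennreal_def top_unique)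
  moreover have "enn2real ?I powr (1 / p) \<le> \<theta>"
  proof -
    have "enn2real ?I \<le> \<theta> powr p"
      using enn2real_mono[OF I] by simp
    then have "enn2real ?I powr (1 / p) \<le> (\<theta> powr p) powr (1 / p)"
      using assms by (intro powr_mono2) auto
    also have "\<dots> = \<theta>" using assms by (auto simp: powr_powr)
    finally show ?thesis .
  qed
  ultimately have "wasserstein p ?P P' \<le> ennreal \<theta>"
    unfolding wasserstein_def ennreal_root_def by (simp only: if_False ennreal_leI)
  then show "?P \<in> wasserstein_ball \<theta> p P'"
    by (auto simp: wasserstein_ball_def sym_prob_measures_def intro!: prob_space_distr)
  show "(\<integral>Q. quad_form Q x \<partial>?P) = (\<integral>Q. quad_form Q x \<partial>P') + quad_form S x"
    if "integrable P' (\<lambda>Q. quad_form Q x)"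
    using that by (subst integral_distr) (auto simp: quad_form_add prob_space)
qed

lemma dro_objective_eq:
  assumes P': "P' \<in> sym_prob_measures" and "x \<noteq> 0" "p \<ge> 1" "\<theta> > 0"
    and int: "integrable P' (\<lambda>Q. quad_form Q x)"
  shows "dro_objective \<theta> p P' x = ereal ((\<integral>Q. quad_form Q x \<partial>P') + \<theta> * (norm x)\<^sup>2)"
proof (rule antisym)
  show "dro_objective \<theta> p P' x \<le> ereal ((\<integral>Q. quad_form Q x \<partial>P') + \<theta> * (norm x)\<^sup>2)"
    unfolding dro_objective_def
    using assms by (intro SUP_least) (auto intro: expectation_le_of_wasserstein)
  have S: "worst_shift \<theta> x \<in> sym_mats" "norm (worst_shift \<theta> x) = \<theta>"
    "quad_form (worst_shift \<theta> x) x = \<theta> * (norm x)\<^sup>2"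
    using assms by (auto simp: worst_shift)
  show "ereal ((\<integral>Q. quad_form Q x \<partial>P') + \<theta> * (norm x)\<^sup>2) \<le> dro_objective \<theta> p P' x"
    unfolding dro_objective_def
    using shifted_measure_in_wasserstein_ball[OF P' S(1,2) \<open>p \<ge> 1\<close>] int
    by (intro SUP_upper2[where i = "distr P' sym_borel (\<lambda>Q. Q + worst_shift \<theta> x)"]) (auto simp: S)
qed

lemma empirical_measure:
  assumes "N \<ge> 1" "\<And>i. i \<in> {1..N} \<Longrightarrow> Q i \<in> sym_mats"
  shows empirical_measure_prob: "empirical_measure N Q \<in> sym_prob_measures"
    and integrable_empirical: "integrable (empirical_measure N Q) (\<lambda>A. quad_form A x)"
    and integral_empirical: "(\<integral>A. quad_form A x \<partial>empirical_measure N Q) = quad_form (sample_mean N Q) x"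
proof -
  have Q[measurable]: "Q \<in> measurable (uniform_count_measure {1..N}) sym_borel"
    using assms(2)
    by (auto simp: sym_borel_def measurable_def space_uniform_count_measure
        sets_uniform_count_measure space_restrict_space)
  interpret U: prob_space "uniform_count_measure {1..N}"
    using assms(1) by (intro prob_space_uniform_count_measure) auto
  show "empirical_measure N Q \<in> sym_prob_measures"
    unfolding empirical_measure_def sym_prob_measures_def
    using U.prob_space_distr[OF Q] by (simp only: mem_Collect_eq sets_distr simp_thms)
  show "integrable (empirical_measure N Q) (\<lambda>A. quad_form A x)"
    unfolding empirical_measure_def
    by (subst integrable_distr_eq[OF Q]) (auto simp: uniform_count_measure_def integrable_point_measure_finite)
  show "(\<integral>A. quad_form A x \<partial>empirical_measure N Q) = quad_form (sample_mean N Q) x"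
    unfolding empirical_measure_def
    by (subst integral_distr[OF Q quad_form_measurable_sym])
       (auto simp: uniform_count_measure_def lebesgue_integral_point_measure_finite sample_mean_def
         quad_form_eq_inner_outer inner_sum_right sum_distrib_left sum_divide_distrib)
qed

section \<open>Value-at-Risk and quantiles of laws with a density\<close>

lemma VaR_eqI:
  assumes "\<And>t. \<alpha> \<le> measure M {\<omega> \<in> space M. Z \<omega> \<le> t} \<longleftrightarrow> q \<le> t"
  shows "VaR M \<alpha> Z = ereal q"
  unfolding VaR_def assms by (intro antisym Inf_lower Inf_greatest) auto

lemma VaR_cong:
  assumes "\<And>\<omega>. \<omega> \<in> space M \<Longrightarrow> Z \<omega> = Z' \<omega>"
  shows "VaR M \<alpha> Z = VaR M \<alpha> Z'"
  unfolding VaR_def using assms by (simp cong: conj_cong)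

text \<open>
  The two conditions on \<open>q\<close> say that \<open>q\<close> is the least point at which the distribution
  function reaches \<open>\<alpha>\<close>; the set in the definition of Value-at-Risk is then a closed half-line.
\<close>

lemma VaR_affine:
  fixes f :: "real \<Rightarrow> real"
  assumes "prob_space M" and T: "distributed M lborel T f" and "s > 0"
    and q: "cdf (density lborel f) q = \<alpha>" "\<And>u. u < q \<Longrightarrow> cdf (density lborel f) u < \<alpha>"
  shows "VaR M \<alpha> (\<lambda>\<omega>. m + s * T \<omega>) = ereal (m + s * q)"
proof (rule VaR_eqI)
  fix t
  interpret prob_space M by fact
  let ?F = "cdf (density lborel f)"
  have eq: "distr M lborel T = density lborel f" and T'[measurable]: "T \<in> borel_measurable M"
    using T by (auto simp: distributed_def)
  have "real_distribution (distr M lborel T)"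
    using prob_space_distr[of T lborel] by (auto simp: real_distribution_def real_distribution_axioms_def)
  then interpret D: real_distribution "density lborel f" unfolding eq .
  have "measure M {\<omega> \<in> space M. m + s * T \<omega> \<le> t} = measure M {\<omega> \<in> space M. T \<omega> \<le> (t - m) / s}"
    using \<open>s > 0\<close> by (intro arg_cong[where f = "measure M"] Collect_cong) (auto simp: field_simps)
  also have "\<dots> = ?F ((t - m) / s)"
    unfolding cdf_def eq[symmetric] by (subst measure_distr) (auto intro!: arg_cong[where f = "measure M"])
  finally have "\<alpha> \<le> measure M {\<omega> \<in> space M. m + s * T \<omega> \<le> t} \<longleftrightarrow> \<alpha> \<le> ?F ((t - m) / s)" by simp
  also have "\<dots> \<longleftrightarrow> q \<le> (t - m) / s"
    using q D.cdf_nondecreasing[of q "(t - m) / s"] by (meson linorder_not_le)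
  also have "\<dots> \<longleftrightarrow> m + s * q \<le> t"
    using \<open>s > 0\<close> by (auto simp: field_simps)
  finally show "\<alpha> \<le> measure M {\<omega> \<in> space M. m + s * T \<omega> \<le> t} \<longleftrightarrow> m + s * q \<le> t" .
qed

text \<open>
  Probability laws on the line with a density have continuous distribution functions, so every
  level strictly between 0 and 1 is attained; where the density is positive the function is
  strictly increasing, so the point of attainment is unique there.
\<close>

locale prob_density =
  fixes f :: "real \<Rightarrow> real"
  assumes prob: "prob_space (density lborel f)" and density_measurable[measurable]: "f \<in> borel_measurable borel"
begin

sublocale real_distribution "density lborel f"
  using prob by (simp add: real_distribution_def real_distribution_axioms_def)

lemma cdf_strict:
  assumes "u < v" "\<And>x. u < x \<Longrightarrow> x < v \<Longrightarrow> 0 < f x"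
  shows "cdf (density lborel f) u < cdf (density lborel f) v"
proof -
  have "measure (density lborel f) {u<..v} \<noteq> 0"
  proof
    assume "measure (density lborel f) {u<..v} = 0"
    then have "{u<..v} \<in> null_sets (density lborel f)"
      by (auto simp: null_sets_def emeasure_eq_measure)
    then have "AE x in lborel. x \<in> {u<..v} \<longrightarrow> ennreal (f x) = 0"
      by (subst (asm) null_sets_density_iff) auto
    then have "AE x in lborel. x \<notin> {u<..<v}"
    proof eventually_elim
      case (elim x)
      then show ?case using assms(2)[of x] by (auto simp: ennreal_eq_0_iff)
    qed
    then have "{u<..<v} \<in> null_sets lborel" by (subst AE_iff_null_sets) auto
    then show False using \<open>u < v\<close> by (auto simp: null_sets_def)
  qed
  then show ?thesis
    using cdf_diff_eq[OF \<open>u < v\<close>] measure_nonneg[of "density lborel f" "{u<..v}"] by linarith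
qed

lemma singleton_null: "measure (density lborel f) {x} = 0"
proof -
  have "AE y in lborel. y \<in> {x} \<longrightarrow> ennreal (f y) = 0"
    using AE_lborel_singleton[of x] by (rule eventually_mono) simp
  then have "{x} \<in> null_sets (density lborel f)"
    by (subst null_sets_density_iff) auto
  then show ?thesis by (auto simp: measure_def null_sets_def)
qed

lemma cdf_surj:
  assumes "0 < \<alpha>" "\<alpha> < 1"
  obtains q where "cdf (density lborel f) q = \<alpha>"
proof -
  let ?F = "cdf (density lborel f)"
  have "eventually (\<lambda>x. ?F x < \<alpha>) at_bot" using order_tendstoD(2)[OF cdf_lim_at_bot] assms by auto
  then obtain a where a: "?F a < \<alpha>" by (auto simp: eventually_at_bot_linorder)
  have "eventually (\<lambda>x. ?F x > \<alpha>) at_top" using order_tendstoD(1)[OF cdf_lim_at_top_prob] assms by auto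
  then obtain b where b: "?F b > \<alpha>" by (auto simp: eventually_at_top_linorder)
  have "a \<le> b" using a b cdf_nondecreasing[of b a] by linarith
  moreover have "continuous_on {a..b} ?F"
    by (intro continuous_at_imp_continuous_on) (simp add: isCont_cdf singleton_null)
  ultimately obtain q where "?F q = \<alpha>" using IVT'[of ?F a \<alpha> b] a b by auto
  then show ?thesis by (rule that)
qed

end

lemma prob_density_distributed:
  assumes "prob_space M" "distributed M lborel T (\<lambda>x. ennreal (f x))" "f \<in> borel_measurable borel"
  shows "prob_density f"
proof -
  interpret prob_space M by fact
  have "T \<in> borel_measurable M" "distr M lborel T = density lborel f"
    using assms(2) by (auto simp: distributed_def)
  then show ?thesis using prob_space_distr[of T lborel] assms(3) by (simp add: prob_density_def)
qed

section \<open>The standard normal quantile\<close>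

lemma prob_density_std_normal: "prob_density std_normal_density"
  using real_dist_normal_dist by (simp add: prob_density_def real_distribution_def)

interpretation std_normal: prob_density std_normal_density
  by (rule prob_density_std_normal)

lemma cdf_std_normal_quantile:
  assumes "0 < \<alpha>" "\<alpha> < 1"
  shows "cdf std_normal_distribution (std_normal_quantile \<alpha>) = \<alpha>"
    and "u < std_normal_quantile \<alpha> \<Longrightarrow> cdf std_normal_distribution u < \<alpha>"
proof -
  obtain q where "cdf std_normal_distribution q = \<alpha>" using std_normal.cdf_surj[OF assms] by blast
  then show *: "cdf std_normal_distribution (std_normal_quantile \<alpha>) = \<alpha>"
    unfolding std_normal_quantile_def by (intro f_inv_into_f) auto
  show "cdf std_normal_distribution u < \<alpha>" if "u < std_normal_quantile \<alpha>"
    using std_normal.cdf_strict[OF that] * by (simp add: normal_density_pos)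
qed

text \<open>
  The law is invariant under reflection and has no atom at 0, so the two half-lines have equal
  mass.  Hence the quantile is positive exactly for levels above $1/2$.
\<close>

lemma cdf_std_normal_0: "cdf std_normal_distribution 0 = 1/2"
proof -
  let ?D = std_normal_distribution
  have "distributed ?D lborel (\<lambda>x. x) std_normal_density"
    by (simp add: distributed_def distr_id2)
  then have "distributed ?D lborel (\<lambda>x. 0 + (-1) * x) (normal_density (0 + (-1) * 0) (\<bar>-1\<bar> * 1))"
    by (intro std_normal.normal_density_affine) auto
  then have "distr ?D lborel (\<lambda>x. - x) = ?D"
    by (simp add: distributed_def)
  then have "measure ?D {..0} = measure (distr ?D lborel (\<lambda>x. - x)) {..0}" by simp
  also have "\<dots> = measure ?D {0..}"
    by (subst measure_distr) (auto intro!: arg_cong[where f = "measure ?D"])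
  also have "\<dots> = measure ?D {0} + measure ?D {0<..}"
    by (subst std_normal.finite_measure_Union[symmetric]) (auto intro!: arg_cong[where f = "measure ?D"])
  finally have "measure ?D {..0} = measure ?D {0<..}"
    by (simp add: std_normal.singleton_null)
  moreover have "measure ?D {..0} + measure ?D {0<..} = 1"
  proof -
    have "{..0} \<union> {0<..} = (UNIV :: real set)" by auto
    then show ?thesis
      using std_normal.prob_space
      by (subst std_normal.finite_measure_Union[symmetric]) auto
  qed
  ultimately show ?thesis by (simp add: cdf_def)
qed

lemma std_normal_quantile_pos:
  assumes "1/2 < \<alpha>" "\<alpha> < 1"
  shows "0 < std_normal_quantile \<alpha>"
proof (rule ccontr)
  assume "\<not> ?thesis"
  then have "cdf std_normal_distribution (std_normal_quantile \<alpha>) \<le> cdf std_normal_distribution 0"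
    by (intro std_normal.cdf_nondecreasing) auto
  then show False using cdf_std_normal_quantile(1)[of \<alpha>] assms by (simp add: cdf_std_normal_0)
qed

text \<open>
  A term with coefficient 0 is a point mass, not a normal variable with positive variance, so
  such terms are dropped before the summation theorem for independent normals is applied.
\<close>

lemma (in prob_space) normal_linear_combination:
  assumes "finite I" and indep: "indep_vars (\<lambda>_. borel) X I"
    and \<sigma>: "\<And>i. i \<in> I \<Longrightarrow> 0 < \<sigma> i"
    and X: "\<And>i. i \<in> I \<Longrightarrow> distributed M lborel (X i) (normal_density 0 (\<sigma> i))"
    and ne: "\<exists>i\<in>I. c i \<noteq> 0"
  shows "distributed M lborel (\<lambda>\<omega>. \<Sum>i\<in>I. c i * X i \<omega>) (normal_density 0 (sqrt (\<Sum>i\<in>I. (c i * \<sigma> i)\<^sup>2)))"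
proof -
  define J where "J = {i\<in>I. c i \<noteq> 0}"
  have J: "finite J" "J \<noteq> {}" "J \<subseteq> I" using assms by (auto simp: J_def)
  have "distributed M lborel (\<lambda>\<omega>. \<Sum>i\<in>J. c i * X i \<omega>)
      (normal_density (\<Sum>i\<in>J. 0) (sqrt (\<Sum>i\<in>J. (\<bar>c i\<bar> * \<sigma> i)\<^sup>2)))"
  proof (rule sum_indep_normal)
    show "indep_vars (\<lambda>_. borel) (\<lambda>i \<omega>. c i * X i \<omega>) J"
      by (rule indep_vars_compose2[OF indep_vars_subset[OF indep J(3)]]) auto
    show "distributed M lborel (\<lambda>\<omega>. c i * X i \<omega>) (normal_density 0 (\<bar>c i\<bar> * \<sigma> i))" if "i \<in> J" for i
      using normal_density_affine[OF X \<sigma>, of i "c i" 0] that by (auto simp: J_def)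
  qed (use J \<sigma> in \<open>auto simp: J_def\<close>)
  moreover have "(\<Sum>i\<in>J. c i * X i \<omega>) = (\<Sum>i\<in>I. c i * X i \<omega>)" for \<omega>
    using assms(1) by (intro sum.mono_neutral_left) (auto simp: J_def)
  moreover have "(\<Sum>i\<in>J. (\<bar>c i\<bar> * \<sigma> i)\<^sup>2) = (\<Sum>i\<in>I. (c i * \<sigma> i)\<^sup>2)"
    unfolding power_mult_distrib power2_abs using assms(1)
    by (intro sum.mono_neutral_left) (auto simp: J_def)
  ultimately show ?thesis by simp
qed

section \<open>Gamma distributions\<close>

text \<open>
  The density of the Gamma law with shape \<open>a\<close> and rate 1.
\<close>

definition gamma_density :: "real \<Rightarrow> real \<Rightarrow> real" where
  "gamma_density a x = (if 0 < x then x powr (a - 1) * exp (- x) / Gamma a else 0)"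

lemma gamma_density_measurable [measurable]: "gamma_density a \<in> borel_measurable borel"
  unfolding gamma_density_def by measurable

lemma gamma_density_nonneg: "a > 0 \<Longrightarrow> 0 \<le> gamma_density a x"
  by (simp add: gamma_density_def Gamma_real_nonneg)

lemma reg_lower_gamma_eq_cdf:
  assumes "a > 0"
  shows "reg_lower_gamma a x = cdf (density lborel (gamma_density a)) x"
proof -
  have "reg_lower_gamma a x = (\<integral>t. gamma_density a t * indicator {..x} t \<partial>lborel)"
    unfolding reg_lower_gamma_def set_lebesgue_integral_def
    by (subst integral_mult_right_zero[symmetric], intro Bochner_Integration.integral_cong)
       (auto simp: gamma_density_def split: split_indicator)
  also have "\<dots> = enn2real (\<integral>\<^sup>+t. gamma_density a t * indicator {..x} t \<partial>lborel)"
    using gamma_density_nonneg[OF assms] by (intro integral_eq_nn_integral) auto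
  also have "\<dots> = cdf (density lborel (gamma_density a)) x"
    unfolding cdf_def measure_def
    by (subst emeasure_density) (auto intro!: arg_cong[where f = enn2real] nn_integral_cong split: split_indicator)
  finally show ?thesis .
qed

text \<open>
  The function \<^const>\<open>inv_reg_lower_gamma\<close> picks a preimage in $[0,\infty)$.  The density
  is positive on $(0,\infty)$ and the law has no mass on $(-\infty,0]$, so for a level in $(0,1)$
  the preimage is positive and is the least point of the whole line that reaches the level.
\<close>

lemma cdf_inv_reg_lower_gamma:
  assumes "a > 0" "prob_density (gamma_density a)" "0 < \<alpha>" "\<alpha> < 1"
  shows "cdf (density lborel (gamma_density a)) (inv_reg_lower_gamma a \<alpha>) = \<alpha>"
    and "u < inv_reg_lower_gamma a \<alpha> \<Longrightarrow> cdf (density lborel (gamma_density a)) u < \<alpha>"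
proof -
  let ?F = "cdf (density lborel (gamma_density a))"
  interpret prob_density "gamma_density a" by fact
  have F: "reg_lower_gamma a = ?F" using reg_lower_gamma_eq_cdf[OF \<open>a > 0\<close>] by auto
  have F0: "?F 0 = 0"
  proof -
    have "{..0} \<in> null_sets (density lborel (gamma_density a))"
      by (subst null_sets_density_iff) (auto simp: gamma_density_def)
    then show ?thesis by (auto simp: cdf_def measure_def null_sets_def)
  qed
  obtain q where q: "?F q = \<alpha>" using cdf_surj assms by blast
  then have "q \<ge> 0" using cdf_nondecreasing[of q 0] F0 \<open>0 < \<alpha>\<close> by force
  then have "\<alpha> \<in> ?F ` {0..}" using q by auto
  note mem = inv_into_into[OF this] and eq = f_inv_into_f[OF this]
  show *: "?F (inv_reg_lower_gamma a \<alpha>) = \<alpha>"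
    using eq by (simp add: inv_reg_lower_gamma_def F)
  assume u: "u < inv_reg_lower_gamma a \<alpha>"
  have "inv_reg_lower_gamma a \<alpha> \<noteq> 0" using * F0 \<open>0 < \<alpha>\<close> by force
  then have "max 0 u < inv_reg_lower_gamma a \<alpha>" using mem u by (auto simp: inv_reg_lower_gamma_def F)
  then have "?F (max 0 u) < ?F (inv_reg_lower_gamma a \<alpha>)"
    using \<open>a > 0\<close> by (intro cdf_strict) (auto simp: gamma_density_def Gamma_real_pos)
  then show "?F u < \<alpha>" using * cdf_nondecreasing[of u "max 0 u"] by simp
qed

text \<open>
  The substitution $y = x u$ separates the variables: the power $x^{a+b-1}$ and $e^{-x}$ come out,
  and what remains is the Beta integral $B(b,a) = \Gamma(a)\Gamma(b)/\Gamma(a+b)$.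
\<close>

lemma gamma_density_convolution:
  assumes "a > 0" "b > 0"
  shows "(\<integral>\<^sup>+y. ennreal (gamma_density a (x - y)) * ennreal (gamma_density b y) \<partial>lborel) = ennreal (gamma_density (a + b) x)"
proof (cases "x > 0")
  case False
  then have "gamma_density a (x - y) = 0 \<or> gamma_density b y = 0" for y
    by (auto simp: gamma_density_def)
  then have "(\<integral>\<^sup>+y. ennreal (gamma_density a (x - y)) * ennreal (gamma_density b y) \<partial>lborel) = (\<integral>\<^sup>+y. 0 \<partial>(lborel :: real measure))"
    by (intro nn_integral_cong) (metis ennreal_0 mult_zero_left mult_zero_right)
  then show ?thesis using False by (simp add: gamma_density_def)
next
  case True
  let ?C = "x powr (a + b - 2) * exp (- x) / (Gamma a * Gamma b)"
  have pos: "Gamma a > 0" "Gamma b > 0" "Gamma (a + b) > 0" using assms by (auto intro: Gamma_real_pos)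
  have "(\<integral>\<^sup>+y. ennreal (gamma_density a (x - y)) * ennreal (gamma_density b y) \<partial>lborel)
      = ennreal \<bar>x\<bar> * (\<integral>\<^sup>+u. ennreal (gamma_density a (x - (0 + x * u))) * ennreal (gamma_density b (0 + x * u)) \<partial>lborel)"
    using True by (intro nn_integral_real_affine) auto
  also have "(\<integral>\<^sup>+u. ennreal (gamma_density a (x - (0 + x * u))) * ennreal (gamma_density b (0 + x * u)) \<partial>lborel)
     = (\<integral>\<^sup>+u. ennreal ?C * (ennreal (u powr (b - 1) * (1 - u) powr (a - 1)) * indicator {0..1} u) \<partial>lborel)"
  proof (intro nn_integral_cong)
    fix u :: real
    consider "0 < u" "u < 1" | "u \<le> 0" | "1 \<le> u" by linarith
    then show "ennreal (gamma_density a (x - (0 + x * u))) * ennreal (gamma_density b (0 + x * u))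
       = ennreal ?C * (ennreal (u powr (b - 1) * (1 - u) powr (a - 1)) * indicator {0..1} u)"
    proof cases
      case 1
      have *: "x - x * u = x * (1 - u)" by (simp add: algebra_simps)
      have e: "exp (- (x * (1 - u))) * exp (- (x * u)) = exp (- x)"
        by (simp add: exp_add[symmetric] algebra_simps)
      have p: "x powr (a - 1) * x powr (b - 1) = x powr (a + b - 2)"
        by (simp add: powr_add[symmetric] algebra_simps)
      have "gamma_density a (x - x * u) * gamma_density b (x * u)
        = ?C * (u powr (b - 1) * (1 - u) powr (a - 1))"
        using 1 True unfolding * e[symmetric] p[symmetric]
        by (simp add: gamma_density_def powr_mult)
      then show ?thesis using 1 assms by (simp add: ennreal_mult[symmetric] gamma_density_nonneg pos less_imp_le)
    next
      case 2
      then have "x * u \<le> 0" using True by (simp add: mult_le_0_iff)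
      then show ?thesis using 2 by (auto simp: gamma_density_def split: split_indicator)
    next
      case 3
      then have "x * u \<ge> x" using True by simp
      then show ?thesis using 3 by (auto simp: gamma_density_def split: split_indicator)
    qed
  qed
  also have "\<dots> = ennreal ?C * (\<integral>\<^sup>+u. ennreal (u powr (b - 1) * (1 - u) powr (a - 1)) * indicator {0..1} u \<partial>lborel)"
    by (rule nn_integral_cmult) measurable
  also have "(\<integral>\<^sup>+u. ennreal (u powr (b - 1) * (1 - u) powr (a - 1)) * indicator {0..1} u \<partial>lborel) = ennreal (Beta b a)"
    using assms by (intro nn_integral_has_integral_lebesgue' has_integral_Beta_real) auto
  also have "ennreal \<bar>x\<bar> * (ennreal ?C * ennreal (Beta b a)) = ennreal (x * (?C * Beta b a))"
    using True pos by (simp add: ennreal_mult[symmetric] Beta_def add.commute)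
  also have "x * (?C * Beta b a) = gamma_density (a + b) x"
  proof -
    have "x powr (a + b - 1) = x * x powr (a + b - 2)" using True by (simp add: powr_mult_base)
    moreover have "Beta b a = Gamma a * Gamma b / Gamma (a + b)" by (simp add: Beta_def add.commute)
    ultimately show ?thesis using True pos by (simp add: gamma_density_def field_simps)
  qed
  finally show ?thesis .
qed

lemma (in prob_space) sum_indep_gamma:
  assumes "finite I" "I \<noteq> {}" "indep_vars (\<lambda>_. borel) X I"
    and "\<And>i. i \<in> I \<Longrightarrow> 0 < a i"
    and "\<And>i. i \<in> I \<Longrightarrow> distributed M lborel (X i) (gamma_density (a i))"
  shows "distributed M lborel (\<lambda>\<omega>. \<Sum>i\<in>I. X i \<omega>) (gamma_density (\<Sum>i\<in>I. a i))"
  using assms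
proof (induct I rule: finite_ne_induct)
  case (singleton i)
  then show ?case by simp
next
  case (insert i I)
  have "distributed M lborel (\<lambda>\<omega>. \<Sum>i\<in>I. X i \<omega>) (gamma_density (\<Sum>i\<in>I. a i))"
    using insert.prems by (intro insert.hyps) (auto intro: indep_vars_subset)
  then have "distributed M lborel (\<lambda>\<omega>. X i \<omega> + (\<Sum>i\<in>I. X i \<omega>))
      (\<lambda>x. \<integral>\<^sup>+y. ennreal (gamma_density (a i) (x - y)) * ennreal (gamma_density (\<Sum>i\<in>I. a i) y) \<partial>lborel)"
    using insert by (intro distributed_convolution indep_vars_sum) auto
  also have "(\<lambda>x. \<integral>\<^sup>+y. ennreal (gamma_density (a i) (x - y)) * ennreal (gamma_density (\<Sum>i\<in>I. a i) y) \<partial>lborel)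
      = (\<lambda>x. ennreal (gamma_density (a i + (\<Sum>i\<in>I. a i)) x))"
    using insert by (intro ext gamma_density_convolution) (auto intro: sum_pos)
  finally show ?case using insert by simp
qed

text \<open>
  Substituting $x = z^2/2$ turns $x^{-1/2} e^{-x}\,dx / \Gamma(1/2)$ into
  $\sqrt{2/\pi}\, e^{-z^2/2}\,dz$, which is twice the standard normal density, because
  $\Gamma(1/2) = \sqrt\pi$.
\<close>

lemma gamma_half_substitution:
  assumes "b \<ge> 0"
  shows "(\<integral>\<^sup>+x. ennreal (gamma_density (1/2) x) * indicator {..b\<^sup>2/2} x \<partial>lborel)
       = 2 * (\<integral>\<^sup>+z. ennreal (std_normal_density z) * indicator {0..b} z \<partial>lborel)"
proof -
  let ?g = "\<lambda>z::real. z\<^sup>2 / 2"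
  have "(\<integral>\<^sup>+x. ennreal (gamma_density (1/2) x) * indicator {..?g b} x \<partial>lborel)
      = (\<integral>\<^sup>+x. gamma_density (1/2) x * indicator {?g 0..?g b} x \<partial>lborel)"
    by (intro nn_integral_cong) (auto simp: gamma_density_def split: split_indicator)
  also have "\<dots> = (\<integral>\<^sup>+z. gamma_density (1/2) (?g z) * z * indicator {0..b} z \<partial>lborel)"
  proof (rule nn_integral_substitution)
    show "set_borel_measurable borel {?g 0..?g b} (gamma_density (1/2))"
      unfolding set_borel_measurable_def by measurable
  qed (use assms in \<open>auto intro!: derivative_eq_intros continuous_intros\<close>)
  also have "\<dots> = (\<integral>\<^sup>+z. 2 * (ennreal (std_normal_density z) * indicator {0..b} z) \<partial>lborel)"
  proof (rule nn_integral_cong_AE)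
    show "AE z in lborel. ennreal (gamma_density (1/2) (?g z) * z * indicator {0..b} z)
        = 2 * (ennreal (std_normal_density z) * indicator {0..b} z)"
      \<comment> \<open>at 0 the left-hand side vanishes and the right-hand side does not\<close>
      using AE_lborel_singleton[of 0]
    proof eventually_elim
      case (elim z)
      have "gamma_density (1/2) (?g z) * z = 2 * std_normal_density z" if "z > 0"
      proof -
        have "(z\<^sup>2 / 2) powr (-1/2) = sqrt 2 / z"
          using that by (simp add: powr_minus powr_half_sqrt real_sqrt_divide field_simps)
        then have "gamma_density (1/2) (?g z) * z = sqrt 2 / sqrt pi * exp (- (z\<^sup>2 / 2))"
          using that by (simp add: gamma_density_def Gamma_one_half_real)
        also have "sqrt 2 / sqrt pi = 2 / sqrt (2 * pi)"
          by (simp add: real_sqrt_mult field_simps)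
        finally show ?thesis by (simp add: std_normal_density_def)
      qed
      then show ?case using elim by (auto simp: ennreal_mult split: split_indicator)
    qed
  qed
  also have "\<dots> = 2 * (\<integral>\<^sup>+z. ennreal (std_normal_density z) * indicator {0..b} z \<partial>lborel)"
    by (rule nn_integral_cmult) measurable
  finally show ?thesis .
qed

text \<open>
  The event $Z^2/2 \le b^2/2$ is $-b \le Z \le b$.  By symmetry its probability is twice that
  of $0 \le Z \le b$, the factor 2 produced by the substitution above.
\<close>

lemma (in prob_space) gamma_half_square_std_normal:
  assumes Z: "distributed M lborel Z std_normal_density"
  shows "distributed M lborel (\<lambda>\<omega>. (Z \<omega>)\<^sup>2 / 2) (gamma_density (1/2))"
proof (rule distributedI_borel_atMost[where g = "\<lambda>t. prob {\<omega>\<in>space M. (Z \<omega>)\<^sup>2 / 2 \<le> t}"])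
  have [measurable]: "Z \<in> borel_measurable M" and eq: "distr M lborel Z = std_normal_distribution"
    using Z by (auto simp: distributed_def)
  show "(\<lambda>\<omega>. (Z \<omega>)\<^sup>2 / 2) \<in> borel_measurable M" by measurable
  show "gamma_density (1/2) \<in> borel_measurable borel" by measurable
  show "AE x in lborel. 0 \<le> gamma_density (1/2) x" by (simp add: gamma_density_nonneg)
  show "emeasure M {\<omega>\<in>space M. (Z \<omega>)\<^sup>2 / 2 \<le> t} = ennreal (prob {\<omega>\<in>space M. (Z \<omega>)\<^sup>2 / 2 \<le> t})" for t
    by (rule emeasure_eq_measure)
  have "(\<integral>\<^sup>+x. ennreal (gamma_density (1/2) x) * indicator {..t} x \<partial>lborel)
     = ennreal (prob {\<omega>\<in>space M. (Z \<omega>)\<^sup>2 / 2 \<le> t})" for t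
  proof (cases "t < 0")
    case True
    then have neg: "\<not> (Z \<omega>)\<^sup>2 / 2 \<le> t" for \<omega> using zero_le_power2[of "Z \<omega>"] by linarith
    have "(\<integral>\<^sup>+x. ennreal (gamma_density (1/2) x) * indicator {..t} x \<partial>lborel) = (\<integral>\<^sup>+x. 0 \<partial>(lborel :: real measure))"
      using True by (intro nn_integral_cong) (auto simp: gamma_density_def split: split_indicator)
    then show ?thesis using neg by simp
  next
    case False
    define b where "b = sqrt (2 * t)"
    have b: "b \<ge> 0" "t = b\<^sup>2 / 2" using False by (auto simp: b_def)
    let ?I = "\<lambda>A. \<integral>\<^sup>+z. ennreal (std_normal_density z) * indicator A z \<partial>lborel"
    have "ennreal (prob {\<omega>\<in>space M. (Z \<omega>)\<^sup>2 / 2 \<le> t}) = emeasure M (Z -` {-b..b} \<inter> space M)"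
      unfolding emeasure_eq_measure b(2) using b(1)
      by (intro arg_cong[where f = "\<lambda>A. ennreal (prob A)"])
         (auto simp: abs_le_square_iff[symmetric] abs_le_iff power2_le_iff_abs_le)
    also have "\<dots> = emeasure (distr M lborel Z) {-b..b}"
      by (subst emeasure_distr) auto
    also have "\<dots> = ?I {-b..b}"
      unfolding eq by (subst emeasure_density) auto
    also have "\<dots> = (\<integral>\<^sup>+z. ennreal (std_normal_density z) * indicator {-b..0} z + ennreal (std_normal_density z) * indicator {0..b} z \<partial>lborel)"
    proof (rule nn_integral_cong_AE)
      show "AE z in lborel. ennreal (std_normal_density z) * indicator {-b..b} z =
          ennreal (std_normal_density z) * indicator {-b..0} z + ennreal (std_normal_density z) * indicator {0..b} z"
        using AE_lborel_singleton[of 0] by eventually_elim (use b(1) in \<open>auto split: split_indicator\<close>)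
    qed
    also have "\<dots> = ?I {-b..0} + ?I {0..b}"
      by (rule nn_integral_add) measurable
    also have "?I {-b..0} = ennreal \<bar>-1\<bar> * (\<integral>\<^sup>+z. ennreal (std_normal_density (0 + (-1) * z)) * indicator {-b..0} (0 + (-1) * z) \<partial>lborel)"
      by (intro nn_integral_real_affine) auto
    also have "\<dots> = ?I {0..b}"
      by (auto intro!: nn_integral_cong simp: std_normal_density_def split: split_indicator)
    also have "?I {0..b} + ?I {0..b} = (\<integral>\<^sup>+x. ennreal (gamma_density (1/2) x) * indicator {..t} x \<partial>lborel)"
      unfolding b(2) gamma_half_substitution[OF b(1)] by (simp add: mult_2)
    finally show ?thesis by simp
  qed
  then show "(\<integral>\<^sup>+x. gamma_density (1/2) x * indicator {..t} x \<partial>lborel)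
     = ennreal (prob {\<omega>\<in>space M. (Z \<omega>)\<^sup>2 / 2 \<le> t})" for t
    by (simp add: ennreal_mult' ennreal_indicator gamma_density_nonneg)
qed

section \<open>Linear functionals of a standard multivariate normal vector\<close>

text \<open>
  By Tonelli, both measures give a box the product of the masses of its sides, and a product measure
  is determined by its values on boxes.
\<close>

lemma density_PiM:
  fixes M :: "'i \<Rightarrow> 'a measure" and g :: "'i \<Rightarrow> 'a \<Rightarrow> ennreal"
  assumes "finite I" "\<And>i. sigma_finite_measure (M i)" "\<And>i. sigma_finite_measure (density (M i) (g i))"
    and [measurable]: "\<And>i. g i \<in> borel_measurable (M i)"
  shows "density (PiM I M) (\<lambda>x. \<Prod>i\<in>I. g i (x i)) = PiM I (\<lambda>i. density (M i) (g i))"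
proof -
  interpret D: product_sigma_finite "\<lambda>i. density (M i) (g i)" using assms(3) by (simp add: product_sigma_finite_def)
  interpret L: product_sigma_finite M using assms(2) by (simp add: product_sigma_finite_def)
  show ?thesis
  proof (rule D.PiM_eqI[OF \<open>finite I\<close>])
    show "sets (density (PiM I M) (\<lambda>x. \<Prod>i\<in>I. g i (x i))) = sets (PiM I (\<lambda>i. density (M i) (g i)))"
      by (simp cong: sets_PiM_cong)
    fix A assume "\<And>i. i \<in> I \<Longrightarrow> A i \<in> sets (density (M i) (g i))"
    then have A[measurable]: "\<And>i. i \<in> I \<Longrightarrow> A i \<in> sets (M i)" by simp
    have "Pi\<^sub>E I A \<in> sets (PiM I M)" using \<open>finite I\<close> A by (intro sets_PiM_I_finite) auto
    then have "emeasure (density (PiM I M) (\<lambda>x. \<Prod>i\<in>I. g i (x i))) (Pi\<^sub>E I A)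
       = (\<integral>\<^sup>+x. (\<Prod>i\<in>I. g i (x i)) * indicator (Pi\<^sub>E I A) x \<partial>PiM I M)"
      by (subst emeasure_density) auto
    also have "\<dots> = (\<integral>\<^sup>+x. (\<Prod>i\<in>I. g i (x i) * indicator (A i) (x i)) \<partial>PiM I M)"
    proof (rule nn_integral_cong)
      fix x assume "x \<in> space (PiM I M)"
      then have "x \<in> Pi\<^sub>E I A \<longleftrightarrow> (\<forall>i\<in>I. x i \<in> A i)" by (auto simp: space_PiM PiE_iff)
      then have "(indicator (Pi\<^sub>E I A) x :: ennreal) = (\<Prod>i\<in>I. indicator (A i) (x i))"
        using \<open>finite I\<close> by (auto simp: indicator_def prod_zero_iff)
      then show "(\<Prod>i\<in>I. g i (x i)) * indicator (Pi\<^sub>E I A) x = (\<Prod>i\<in>I. g i (x i) * indicator (A i) (x i))"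
        by (simp add: prod.distrib)
    qed
    also have "\<dots> = (\<Prod>i\<in>I. \<integral>\<^sup>+y. g i y * indicator (A i) y \<partial>M i)"
      using A by (intro L.product_nn_integral_prod \<open>finite I\<close>) auto
    also have "\<dots> = (\<Prod>i\<in>I. emeasure (density (M i) (g i)) (A i))"
      using A by (intro prod.cong) (auto simp: emeasure_density)
    finally show "emeasure (density (PiM I M) (\<lambda>x. \<Prod>i\<in>I. g i (x i))) (Pi\<^sub>E I A)
       = (\<Prod>i\<in>I. emeasure (density (M i) (g i)) (A i))" .
  qed
qed

lemma power2_norm_eq_sum_Basis: "(norm v)\<^sup>2 = (\<Sum>b\<in>Basis. (v \<bullet> b)\<^sup>2)"
  unfolding power2_norm_eq_inner by (subst euclidean_inner) (simp add: power2_eq_square)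

lemma std_mvn_density_eq_prod:
  "std_mvn_density (v :: real^'n) = (\<Prod>b\<in>Basis. std_normal_density (v \<bullet> b))"
proof -
  have "(\<Prod>b\<in>Basis. std_normal_density (v \<bullet> b))
      = (1 / sqrt (2 * pi)) ^ CARD('n) * exp (\<Sum>b\<in>Basis. - (v \<bullet> b)\<^sup>2 / 2)"
    unfolding exp_sum[OF finite_Basis] std_normal_density_def prod.distrib prod_constant by simp
  also have "(\<Sum>b\<in>Basis. - (v \<bullet> b)\<^sup>2 / 2) = - (norm v)\<^sup>2 / 2"
    unfolding power2_norm_eq_sum_Basis sum_negf[symmetric] sum_divide_distrib ..
  also have "(1 / sqrt (2 * pi)) ^ CARD('n) = (2 * pi) powr (- real CARD('n) / 2)"
  proof -
    have "1 / sqrt (2 * pi) = (2 * pi) powr (- 1 / 2)"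
      using powr_minus_divide[of "2 * pi" "1/2"] powr_half_sqrt[of "2 * pi"] pi_gt_zero by simp
    then show ?thesis by (simp add: powr_power)
  qed
  finally show ?thesis by (simp add: std_mvn_density_def)
qed

text \<open>
  Lebesgue measure on a Euclidean space is the image of the product of the Lebesgue measures on the
  coordinate axes, and the multivariate normal density factorizes over the coordinates.
\<close>

lemma density_std_mvn:
  "density lborel (std_mvn_density :: real^'n \<Rightarrow> real)
   = distr (\<Pi>\<^sub>M b\<in>Basis. std_normal_distribution) borel (\<lambda>f. \<Sum>b\<in>Basis. f b *\<^sub>R b)"
proof -
  let ?h = "\<lambda>f. \<Sum>b\<in>Basis. f b *\<^sub>R (b :: real^'n)"
  have [measurable]: "(std_mvn_density :: real^'n \<Rightarrow> real) \<in> borel_measurable borel"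
    unfolding std_mvn_density_def by measurable
  have h: "?h f \<bullet> b = f b" if "b \<in> Basis" for f and b :: "real^'n"
    using that by (simp add: inner_sum_left inner_Basis if_distrib cong: if_cong)
  have "density lborel (std_mvn_density :: real^'n \<Rightarrow> real)
     = density (distr (\<Pi>\<^sub>M b\<in>Basis. lborel) borel ?h) std_mvn_density"
    by (subst lborel_eq) simp
  also have "\<dots> = distr (density (\<Pi>\<^sub>M b\<in>Basis. lborel) (\<lambda>f. std_mvn_density (?h f))) borel ?h"
    by (rule density_distr) measurable
  also have "(\<lambda>f. ennreal (std_mvn_density (?h f))) = (\<lambda>f. \<Prod>b\<in>Basis. ennreal (std_normal_density (f b)))"
    by (simp add: std_mvn_density_eq_prod h prod_ennreal)
  also have "density (\<Pi>\<^sub>M b\<in>(Basis :: (real^'n) set). lborel) (\<lambda>f. \<Prod>b\<in>Basis. ennreal (std_normal_density (f b)))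
     = (\<Pi>\<^sub>M b\<in>Basis. std_normal_distribution)"
    using prob_space_imp_sigma_finite[OF std_normal.prob]
    by (intro density_PiM) (auto intro: lborel.sigma_finite_measure_axioms)
  finally show ?thesis .
qed

text \<open>
  Reading off coordinates inverts the map that assembles a vector from them, so the joint law of the
  coordinates is the product measure itself.
\<close>

lemma (in prob_space) std_mvn_components:
  fixes Y :: "'a \<Rightarrow> real^'n"
  assumes Y: "distributed M lborel Y std_mvn_density"
  shows "indep_vars (\<lambda>_. borel) (\<lambda>b \<omega>. Y \<omega> \<bullet> b) Basis"
    and "\<And>b. b \<in> Basis \<Longrightarrow> distributed M lborel (\<lambda>\<omega>. Y \<omega> \<bullet> b) std_normal_density"
proof -
  let ?P = "\<Pi>\<^sub>M b\<in>(Basis :: (real^'n) set). std_normal_distribution"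
  let ?h = "\<lambda>f. \<Sum>b\<in>Basis. f b *\<^sub>R (b :: real^'n)"
  have h: "?h f \<bullet> b = f b" if "b \<in> Basis" for f and b :: "real^'n"
    using that by (simp add: inner_sum_left inner_Basis if_distrib cong: if_cong)
  have Ym[measurable]: "Y \<in> borel_measurable M" using Y by (auto simp: distributed_def)
  have "distr M lborel Y = density lborel std_mvn_density" using Y by (simp add: distributed_def)
  moreover have "distr M borel Y = distr M lborel Y" by (intro distr_cong) auto
  ultimately have law: "distr M borel Y = distr ?P borel ?h"
    by (simp add: density_std_mvn)
  have setsP[measurable_cong]: "sets ?P = sets (\<Pi>\<^sub>M b\<in>(Basis :: (real^'n) set). borel)"
    by (intro sets_PiM_cong) auto
  have comp: "distr M borel (\<lambda>\<omega>. Y \<omega> \<bullet> b) = std_normal_distribution" if b: "b \<in> Basis" for b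
  proof -
    have "distr M borel (\<lambda>\<omega>. Y \<omega> \<bullet> b) = distr (distr M borel Y) borel (\<lambda>y. y \<bullet> b)"
      by (subst distr_distr) (auto simp: comp_def)
    also have "\<dots> = distr ?P borel (\<lambda>f. ?h f \<bullet> b)"
      unfolding law by (subst distr_distr) (auto simp: comp_def)
    also have "\<dots> = distr ?P std_normal_distribution (\<lambda>f. f b)"
      using b by (intro distr_cong) (auto simp: h)
    also have "\<dots> = std_normal_distribution"
      using b std_normal.prob by (intro distr_PiM_component) auto
    finally show ?thesis .
  qed
  show "distributed M lborel (\<lambda>\<omega>. Y \<omega> \<bullet> b) std_normal_density" if "b \<in> Basis" for b
    using comp[OF that] by (auto simp: distributed_def cong: distr_cong)
  have "distr M (\<Pi>\<^sub>M b\<in>Basis. borel) (\<lambda>\<omega>. \<lambda>b\<in>Basis. Y \<omega> \<bullet> b)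
      = distr (distr M borel Y) (\<Pi>\<^sub>M b\<in>Basis. borel) (\<lambda>y. \<lambda>b\<in>Basis. y \<bullet> b)"
    by (subst distr_distr) (auto simp: comp_def)
  also have "\<dots> = distr ?P (\<Pi>\<^sub>M b\<in>Basis. borel) (\<lambda>f. \<lambda>b\<in>Basis. ?h f \<bullet> b)"
    unfolding law by (subst distr_distr) (auto simp: comp_def)
  also have "\<dots> = distr ?P (\<Pi>\<^sub>M b\<in>Basis. borel) (\<lambda>f. f)"
    by (intro distr_cong) (auto simp: h space_PiM PiE_iff extensional_def)
  also have "\<dots> = ?P" by (intro distr_id2) (simp add: setsP)
  also have "\<dots> = (\<Pi>\<^sub>M b\<in>Basis. distr M borel (\<lambda>\<omega>. Y \<omega> \<bullet> b))"
    by (intro PiM_cong) (auto simp: comp)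
  finally have joint: "distr M (\<Pi>\<^sub>M b\<in>Basis. borel) (\<lambda>\<omega>. \<lambda>b\<in>Basis. Y \<omega> \<bullet> b)
      = (\<Pi>\<^sub>M b\<in>Basis. distr M borel (\<lambda>\<omega>. Y \<omega> \<bullet> b))" .
  have "indep_vars (\<lambda>_. borel) (\<lambda>b \<omega>. Y \<omega> \<bullet> b) Basis \<longleftrightarrow>
      distr M (\<Pi>\<^sub>M b\<in>Basis. borel) (\<lambda>\<omega>. \<lambda>b\<in>Basis. Y \<omega> \<bullet> b)
      = (\<Pi>\<^sub>M b\<in>Basis. distr M borel (\<lambda>\<omega>. Y \<omega> \<bullet> b))"
  proof (rule indep_vars_iff_distr_eq_PiM'[where M' = "\<lambda>_. borel" and X = "\<lambda>b \<omega>. Y \<omega> \<bullet> b"])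
    show "(Basis :: (real^'n) set) \<noteq> {}" by (rule nonempty_Basis)
    show "(\<lambda>\<omega>. Y \<omega> \<bullet> b) \<in> borel_measurable M" for b by measurable
  qed
  then show "indep_vars (\<lambda>_. borel) (\<lambda>b \<omega>. Y \<omega> \<bullet> b) Basis"
    using joint by (rule iffD2)
qed

lemma (in prob_space) std_mvn_inner:
  fixes Y :: "'a \<Rightarrow> real^'n"
  assumes Y: "distributed M lborel Y std_mvn_density" and "x \<noteq> 0"
  shows "distributed M lborel (\<lambda>\<omega>. x \<bullet> Y \<omega>) (normal_density 0 (norm x))"
proof -
  have "\<exists>b\<in>Basis. x \<bullet> b \<noteq> 0" using \<open>x \<noteq> 0\<close> euclidean_all_zero_iff[of x] by blast
  then have "distributed M lborel (\<lambda>\<omega>. \<Sum>b\<in>Basis. (x \<bullet> b) * (Y \<omega> \<bullet> b))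
     (normal_density 0 (sqrt (\<Sum>b\<in>Basis. ((x \<bullet> b) * 1)\<^sup>2)))"
    by (intro normal_linear_combination[where \<sigma> = "\<lambda>_. 1"] std_mvn_components[OF Y]) simp_all
  moreover have "(\<Sum>b\<in>Basis. (x \<bullet> b) * (Y \<omega> \<bullet> b)) = x \<bullet> Y \<omega>" for \<omega>
    by (rule euclidean_inner[symmetric])
  moreover have "sqrt (\<Sum>b\<in>Basis. ((x \<bullet> b) * 1)\<^sup>2) = norm x"
    unfolding mult_1_right power2_norm_eq_sum_Basis[symmetric] by simp
  ultimately show ?thesis by (simp only:)
qed

section \<open>Chance constraints\<close>

text \<open>
  The entries below the diagonal repeat those above it.  The GOE prescribes independence only for
  entries on and above the diagonal, so sums over all entries have to be folded onto that part.
\<close>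

lemma sum_symmetric_matrix:
  fixes f :: "'n::{finite,linorder} \<Rightarrow> 'n \<Rightarrow> real"
  assumes sym: "\<And>i j. f i j = f j i"
  shows "(\<Sum>i\<in>UNIV. \<Sum>j\<in>UNIV. f i j) = (\<Sum>(i,j)\<in>{(i,j). i \<le> j}. (if i = j then 1 else 2) * f i j)"
proof -
  let ?g = "\<lambda>(i,j). f i j" and ?h = "\<lambda>(i,j). (if i = j then 1 else 2) * f i j"
  let ?L = "{(i,j). i < (j::'n)}" and ?G = "{(i,j). j < (i::'n)}" and ?D = "{(i,j). i = (j::'n)}"
  have U: "(UNIV :: ('n \<times> 'n) set) = (?D \<union> ?L) \<union> ?G" and I: "{(i,j). i \<le> j} = ?D \<union> ?L" by auto
  have "(\<Sum>i\<in>UNIV. \<Sum>j\<in>UNIV. f i j) = sum ?g UNIV"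
    by (simp add: sum.cartesian_product)
  also have "\<dots> = sum ?g (?D \<union> ?L) + sum ?g ?G"
    unfolding U by (rule sum.union_disjoint) auto
  also have "sum ?g (?D \<union> ?L) = sum ?g ?D + sum ?g ?L"
    by (rule sum.union_disjoint) auto
  also have "sum ?g ?G = sum ?g ?L"
    by (rule sum.reindex_bij_witness[where i = prod.swap and j = prod.swap]) (auto intro: sym)
  also have "sum ?g ?D + sum ?g ?L + sum ?g ?L = sum ?g ?D + (\<Sum>p\<in>?L. 2 * ?g p)"
    by (simp add: sum_distrib_left[symmetric])
  also have "sum ?g ?D = sum ?h ?D" by (rule sum.cong) auto
  also have "(\<Sum>p\<in>?L. 2 * ?g p) = sum ?h ?L" by (rule sum.cong) auto
  also have "sum ?h ?D + sum ?h ?L = sum ?h (?D \<union> ?L)"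
    by (rule sum.union_disjoint[symmetric]) auto
  finally show ?thesis unfolding I .
qed

text \<open>
  On the upper triangle the coefficients of the form are $x_i^2$ on the diagonal and $2 x_i x_j$ off
  it, the variances 2 and 1.  The total variance
  $\sum_i 2 x_i^4 + \sum_{i<j} 4 x_i^2 x_j^2$ is the folded sum of $2 x_i^2 x_j^2$ over all pairs,
  that is, $2 \|x\|^4$.
\<close>

lemma GOE_quad_form:
  fixes G :: "'w \<Rightarrow> real^('n::{finite,linorder})^('n::{finite,linorder})"
  assumes "prob_space M" and G: "GOE M G" and "x \<noteq> 0"
  obtains T where "distributed M lborel T std_normal_density"
    "\<And>\<omega>. \<omega> \<in> space M \<Longrightarrow> quad_form (G \<omega>) x = sqrt 2 * (norm x)\<^sup>2 * T \<omega>"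
proof -
  interpret prob_space M by fact
  let ?I = "{(i, j). i \<le> (j::'n)}"
  define c where "c = (\<lambda>(i,j). (if i = (j::'n) then 1 else 2) * (x $ i * x $ j))"
  define \<sigma> where "\<sigma> = (\<lambda>(i,j). if i = (j::'n) then sqrt 2 else 1)"
  define S where "S = (\<lambda>\<omega>. \<Sum>p\<in>?I. c p * (case p of (i,j) \<Rightarrow> \<lambda>\<omega>. G \<omega> $ i $ j) \<omega>)"
  let ?v = "sqrt 2 * (norm x)\<^sup>2"
  have v: "?v > 0" using \<open>x \<noteq> 0\<close> by simp
  have S: "quad_form (G \<omega>) x = S \<omega>" if "\<omega> \<in> space M" for \<omega>
  proof -
    have "G \<omega> \<in> sym_mats" using G that unfolding GOE_def by blast
    note sym = sym_matsD[OF this]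
    have "quad_form (G \<omega>) x = (\<Sum>(i,j)\<in>?I. (if i = j then 1 else 2) * (x $ i * x $ j * G \<omega> $ i $ j))"
      unfolding quad_form_eq_sum
    proof (rule sum_symmetric_matrix)
      show "x $ i * x $ j * G \<omega> $ i $ j = x $ j * x $ i * G \<omega> $ j $ i" for i j
        unfolding sym[of j i] by (simp only: mult.commute)
    qed
    also have "\<dots> = S \<omega>" unfolding S_def by (intro sum.cong) (auto simp: c_def)
    finally show ?thesis .
  qed
  have "(\<Sum>p\<in>?I. (c p * \<sigma> p)\<^sup>2) = (\<Sum>(i,j)\<in>?I. (if i = j then 1 else 2) * (2 * ((x $ i)\<^sup>2 * (x $ j)\<^sup>2)))"
    by (intro sum.cong) (auto simp: c_def \<sigma>_def power_mult_distrib)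
  also have "\<dots> = (\<Sum>i\<in>UNIV. \<Sum>j\<in>UNIV. 2 * ((x $ i)\<^sup>2 * (x $ j)\<^sup>2))"
    by (rule sum_symmetric_matrix[symmetric]) simp
  also have "\<dots> = 2 * ((\<Sum>i\<in>UNIV. (x $ i)\<^sup>2) * (\<Sum>j\<in>UNIV. (x $ j)\<^sup>2))"
    by (subst sum_product) (simp only: sum_distrib_left)
  also have "\<dots> = ?v\<^sup>2"
  proof -
    have "(norm x)\<^sup>2 = (\<Sum>i\<in>UNIV. (x $ i)\<^sup>2)"
      by (simp add: norm_vec_def L2_set_def sum_nonneg)
    then show ?thesis
      by (simp only: power_mult_distrib real_sqrt_pow2[OF zero_le_numeral] power2_eq_square[of "sum _ _"])
  qed
  finally have var: "sqrt (\<Sum>p\<in>?I. (c p * \<sigma> p)\<^sup>2) = ?v" using v by (simp only: real_sqrt_abs abs_of_pos)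
  have "distributed M lborel S (normal_density 0 (sqrt (\<Sum>p\<in>?I. (c p * \<sigma> p)\<^sup>2)))"
    unfolding S_def
  proof (rule normal_linear_combination)
    show "indep_vars (\<lambda>_. borel) (\<lambda>p. case p of (i,j) \<Rightarrow> \<lambda>\<omega>. G \<omega> $ i $ j) ?I"
      using G by (simp add: GOE_def)
    obtain i where "x $ i \<noteq> 0" using \<open>x \<noteq> 0\<close> by (auto simp: vec_eq_iff)
    then show "\<exists>p\<in>?I. c p \<noteq> 0" by (intro bexI[of _ "(i,i)"]) (auto simp: c_def)
    show "distributed M lborel (case p of (i,j) \<Rightarrow> \<lambda>\<omega>. G \<omega> $ i $ j) (normal_density 0 (\<sigma> p))" if "p \<in> ?I" for p
      using G that by (cases p) (auto simp: GOE_def \<sigma>_def order_le_less)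
  qed (auto simp: \<sigma>_def)
  then have "distributed M lborel (\<lambda>\<omega>. (S \<omega> - 0) / ?v) std_normal_density"
    unfolding var by (subst (asm) normal_standard_normal_convert[OF v])
  then show ?thesis using v S by (intro that) auto
qed

lemma quad_form_outer: "quad_form (outer y) x = (x \<bullet> y)\<^sup>2"
  by (simp add: quad_form_eq_sum outer_def inner_vec_def power2_eq_square sum_product algebra_simps)

text \<open>
  Each $(x^T Y_l / \|x\|)^2 / 2$ is a Gamma variable of shape $1/2$, and the shapes of independent
  Gamma variables add up to $k/2$.
\<close>

lemma Wishart_quad_form:
  fixes W :: "'w \<Rightarrow> real^'n^'n"
  assumes "prob_space M" and W: "Wishart M k W" and "x \<noteq> 0" "k \<ge> 1"
  obtains T where "distributed M lborel T (gamma_density (real k / 2))"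
    "\<And>\<omega>. \<omega> \<in> space M \<Longrightarrow> quad_form (W \<omega>) x = 2 * (norm x)\<^sup>2 * T \<omega>"
proof -
  interpret prob_space M by fact
  obtain Y :: "nat \<Rightarrow> 'w \<Rightarrow> real^'n" where Y: "\<And>l. l < k \<Longrightarrow> distributed M lborel (Y l) std_mvn_density"
    and indep: "indep_vars (\<lambda>_. borel) Y {..<k}"
    and W_eq: "\<And>\<omega>. \<omega> \<in> space M \<Longrightarrow> W \<omega> = (\<chi> i j. \<Sum>l<k. Y l \<omega> $ i * Y l \<omega> $ j)"
    using W unfolding Wishart_def by blast
  define T where "T = (\<lambda>\<omega>. \<Sum>l<k. ((x \<bullet> Y l \<omega> - 0) / norm x)\<^sup>2 / 2)"
  have "distributed M lborel T (gamma_density (\<Sum>l<k. 1/2))"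
    unfolding T_def
  proof (rule sum_indep_gamma)
    show "indep_vars (\<lambda>_. borel) (\<lambda>l \<omega>. ((x \<bullet> Y l \<omega> - 0) / norm x)\<^sup>2 / 2) {..<k}"
      by (rule indep_vars_compose2[OF indep, where Y = "\<lambda>l y. ((x \<bullet> y - 0) / norm x)\<^sup>2 / 2"]) measurable
    show "distributed M lborel (\<lambda>\<omega>. ((x \<bullet> Y l \<omega> - 0) / norm x)\<^sup>2 / 2) (gamma_density (1/2))" if "l \<in> {..<k}" for l
      using that \<open>x \<noteq> 0\<close>
      by (intro gamma_half_square_std_normal iffD1[OF normal_standard_normal_convert] std_mvn_inner Y) auto
    have "0 \<in> {..<k}" using \<open>k \<ge> 1\<close> by simp
    then show "{..<k} \<noteq> {}" by blast
  qed simp_all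
  moreover have "quad_form (W \<omega>) x = 2 * (norm x)\<^sup>2 * T \<omega>" if "\<omega> \<in> space M" for \<omega>
  proof -
    have "quad_form (W \<omega>) x = quad_form (\<Sum>l<k. outer (Y l \<omega>)) x"
      by (intro arg_cong[where f = "\<lambda>A. quad_form A x"])
         (simp add: W_eq[OF that] vec_eq_iff outer_def)
    also have "\<dots> = (\<Sum>l<k. quad_form (outer (Y l \<omega>)) x)"
      by (simp add: quad_form_eq_inner_outer inner_sum_right)
    also have "\<dots> = (\<Sum>l<k. (x \<bullet> Y l \<omega>)\<^sup>2)"
      by (simp add: quad_form_outer)
    also have "\<dots> = 2 * (norm x)\<^sup>2 * T \<omega>"
      using \<open>x \<noteq> 0\<close> by (simp add: T_def sum_distrib_left power_divide)
    finally show ?thesis .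
  qed
  ultimately show ?thesis by (intro that) auto
qed

lemma chance_objective_eq:
  fixes f :: "real \<Rightarrow> real"
  assumes "prob_space M" and T: "distributed M lborel T f"
    and q: "cdf (density lborel f) q = \<alpha>" "\<And>u. u < q \<Longrightarrow> cdf (density lborel f) u < \<alpha>"
    and R: "\<And>\<omega>. \<omega> \<in> space M \<Longrightarrow> quad_form (R \<omega>) x = s * (norm x)\<^sup>2 * T \<omega>"
    and pos: "0 < s" "0 < \<beta>" "x \<noteq> 0"
  shows "chance_objective M \<alpha> (\<lambda>\<omega>. Q + \<beta> *\<^sub>R R \<omega>) x = ereal (quad_form Q x + s * \<beta> * q * (norm x)\<^sup>2)"
proof -
  have "chance_objective M \<alpha> (\<lambda>\<omega>. Q + \<beta> *\<^sub>R R \<omega>) x = VaR M \<alpha> (\<lambda>\<omega>. quad_form Q x + (\<beta> * s * (norm x)\<^sup>2) * T \<omega>)"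
    unfolding chance_objective_def
    by (rule VaR_cong) (simp add: quad_form_add quad_form_scale R mult_ac)
  also have "\<dots> = ereal (quad_form Q x + (\<beta> * s * (norm x)\<^sup>2) * q)"
    using assms by (intro VaR_affine) auto
  finally show ?thesis by (simp add: mult_ac)
qed

theorem corollary3p6:
  fixes N :: nat
    and Qhat :: "nat \<Rightarrow> real^('n::{finite,linorder})^('n::{finite,linorder})"
  assumes "N \<ge> 1"
    and "\<And>i. i \<in> {1..N} \<Longrightarrow> Qhat i \<in> sym_mats"
  shows
    "(\<forall>\<theta>>0.
        (\<forall>x\<in>std_simplex. \<exists>Q. is_arg_max (\<lambda>Q. quad_form Q x)
            (\<lambda>Q. Q \<in> uncertainty_set (sample_mean N Qhat) \<theta>) Q) \<and>
        equivalent_min std_simplex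
          (robust_objective (sample_mean N Qhat) \<theta>)
          (stqp_objective (sample_mean N Qhat) \<theta>)) \<and>
     (\<forall>(M :: 'w measure) \<alpha> \<beta> G \<theta>.
        prob_space M \<and> 1/2 < \<alpha> \<and> \<alpha> < 1 \<and> 0 < \<beta> \<and> GOE M G \<and>
        \<theta> = sqrt 2 * \<beta> * std_normal_quantile \<alpha> \<longrightarrow>
          0 < \<theta> \<and>
          equivalent_min std_simplex
            (chance_objective M \<alpha> (\<lambda>\<omega>. sample_mean N Qhat + \<beta> *\<^sub>R G \<omega>))
            (stqp_objective (sample_mean N Qhat) \<theta>)) \<and>
     (\<forall>(M :: 'w measure) \<alpha> \<beta> k W \<theta>.
        prob_space M \<and> 1/2 < \<alpha> \<and> \<alpha> < 1 \<and> 0 < \<beta> \<and> 1 \<le> k \<and> Wishart M k W \<and>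
        \<theta> = 2 * \<beta> * inv_reg_lower_gamma (real k / 2) \<alpha> \<longrightarrow>
          equivalent_min std_simplex
            (chance_objective M \<alpha> (\<lambda>\<omega>. sample_mean N Qhat + \<beta> *\<^sub>R W \<omega>))
            (stqp_objective (sample_mean N Qhat) \<theta>)) \<and>
     (\<forall>p\<ge>1. \<forall>\<theta>>0.
        equivalent_min std_simplex
          (dro_objective \<theta> p (empirical_measure N Qhat))
          (stqp_objective (sample_mean N Qhat) \<theta>))"
proof (intro conjI allI impI; (elim conjE)?)
  fix \<theta> :: real assume \<theta>: "\<theta> > 0"
  have sym: "sample_mean N Qhat \<in> sym_mats" using assms(2) by (rule sample_mean_sym)
  show "\<forall>x\<in>std_simplex. \<exists>Q. is_arg_max (\<lambda>Q. quad_form Q x)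
            (\<lambda>Q. Q \<in> uncertainty_set (sample_mean N Qhat) \<theta>) Q"
    using robust_worst_case(1)[OF std_simplex_nonzero less_imp_le[OF \<theta>] sym] by blast
  show "equivalent_min std_simplex (robust_objective (sample_mean N Qhat) \<theta>)
      (stqp_objective (sample_mean N Qhat) \<theta>)"
    by (intro equivalent_min_stqp robust_worst_case(2) std_simplex_nonzero less_imp_le[OF \<theta>] sym)
next
  fix M :: "'w measure" and \<alpha> \<beta> \<theta> and G :: "'w \<Rightarrow> real^('n::{finite,linorder})^('n::{finite,linorder})"
  assume *: "prob_space M" "1/2 < \<alpha>" "\<alpha> < 1" "0 < \<beta>" "GOE M G" "\<theta> = sqrt 2 * \<beta> * std_normal_quantile \<alpha>"
  show "0 < \<theta>" using * std_normal_quantile_pos[of \<alpha>] by simp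
  show "equivalent_min std_simplex
            (chance_objective M \<alpha> (\<lambda>\<omega>. sample_mean N Qhat + \<beta> *\<^sub>R G \<omega>))
            (stqp_objective (sample_mean N Qhat) \<theta>)"
  proof (rule equivalent_min_stqp)
    fix x :: "real^('n::{finite,linorder})" assume "x \<in> std_simplex"
    then have x: "x \<noteq> 0" by (rule std_simplex_nonzero)
    obtain T where T: "distributed M lborel T std_normal_density"
      "\<And>\<omega>. \<omega> \<in> space M \<Longrightarrow> quad_form (G \<omega>) x = sqrt 2 * (norm x)\<^sup>2 * T \<omega>"
      using GOE_quad_form[OF *(1,5) x] by blast
    show "chance_objective M \<alpha> (\<lambda>\<omega>. sample_mean N Qhat + \<beta> *\<^sub>R G \<omega>) x
        = ereal (quad_form (sample_mean N Qhat) x + \<theta> * (norm x)\<^sup>2)"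
      unfolding *(6)
    proof (rule chance_objective_eq[OF *(1) T(1) _ _ T(2)])
      have "0 < \<alpha>" using *(2) by simp
      from cdf_std_normal_quantile[OF this *(3)]
      show "cdf std_normal_distribution (std_normal_quantile \<alpha>) = \<alpha>"
        "\<And>u. u < std_normal_quantile \<alpha> \<Longrightarrow> cdf std_normal_distribution u < \<alpha>" .
    qed (simp_all add: *(4) x)
  qed
next
  fix M :: "'w measure" and \<alpha> \<beta> \<theta> and k :: nat and W :: "'w \<Rightarrow> real^('n::{finite,linorder})^('n::{finite,linorder})"
  assume *: "prob_space M" "1/2 < \<alpha>" "\<alpha> < 1" "0 < \<beta>" "1 \<le> k" "Wishart M k W"
    "\<theta> = 2 * \<beta> * inv_reg_lower_gamma (real k / 2) \<alpha>"
  show "equivalent_min std_simplex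
            (chance_objective M \<alpha> (\<lambda>\<omega>. sample_mean N Qhat + \<beta> *\<^sub>R W \<omega>))
            (stqp_objective (sample_mean N Qhat) \<theta>)"
  proof (rule equivalent_min_stqp)
    fix x :: "real^('n::{finite,linorder})" assume "x \<in> std_simplex"
    then have x: "x \<noteq> 0" by (rule std_simplex_nonzero)
    obtain T where T: "distributed M lborel T (gamma_density (real k / 2))"
      "\<And>\<omega>. \<omega> \<in> space M \<Longrightarrow> quad_form (W \<omega>) x = 2 * (norm x)\<^sup>2 * T \<omega>"
      using Wishart_quad_form[OF *(1,6) x *(5)] by blast
    have prob: "prob_density (gamma_density (real k / 2))"
      by (rule prob_density_distributed[OF *(1) T(1) gamma_density_measurable])
    show "chance_objective M \<alpha> (\<lambda>\<omega>. sample_mean N Qhat + \<beta> *\<^sub>R W \<omega>) x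
        = ereal (quad_form (sample_mean N Qhat) x + \<theta> * (norm x)\<^sup>2)"
      unfolding *(7)
    proof (rule chance_objective_eq[OF *(1) T(1) _ _ T(2)])
      have "0 < real k / 2" "0 < \<alpha>" using *(2,5) by simp_all
      from cdf_inv_reg_lower_gamma[OF this(1) prob this(2) *(3)]
      show "cdf (density lborel (gamma_density (real k / 2))) (inv_reg_lower_gamma (real k / 2) \<alpha>) = \<alpha>"
        "\<And>u. u < inv_reg_lower_gamma (real k / 2) \<alpha> \<Longrightarrow>
          cdf (density lborel (gamma_density (real k / 2))) u < \<alpha>" .
    qed (simp_all add: *(4) x)
  qed
next
  fix p \<theta> :: real assume p: "p \<ge> 1" and \<theta>: "\<theta> > 0"
  show "equivalent_min std_simplex (dro_objective \<theta> p (empirical_measure N Qhat))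
          (stqp_objective (sample_mean N Qhat) \<theta>)"
  proof (rule equivalent_min_stqp)
    fix x :: "real^('n::{finite,linorder})" assume "x \<in> std_simplex"
    then have x: "x \<noteq> 0" by (rule std_simplex_nonzero)
    have "dro_objective \<theta> p (empirical_measure N Qhat) x
        = ereal ((\<integral>Q. quad_form Q x \<partial>empirical_measure N Qhat) + \<theta> * (norm x)\<^sup>2)"
    proof (rule dro_objective_eq[OF _ x p \<theta>])
      show "empirical_measure N Qhat \<in> sym_prob_measures"
        using assms by (rule empirical_measure_prob)
      show "integrable (empirical_measure N Qhat) (\<lambda>Q. quad_form Q x)"
        using assms by (rule integrable_empirical)
    qed
    also have "(\<integral>Q. quad_form Q x \<partial>empirical_measure N Qhat) = quad_form (sample_mean N Qhat) x"
      using assms by (rule integral_empirical)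
    finally show "dro_objective \<theta> p (empirical_measure N Qhat) x
        = ereal (quad_form (sample_mean N Qhat) x + \<theta> * (norm x)\<^sup>2)" .
  qed
qed

end
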